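(* Let $k,n,i\in\mathbb{Z}$ with $1\le i\le n\le k-1$, and set $I_{k,n,i}=\{(k_1,\dots,k_n)\in\mathbb{Z}_{\ge1}^n\mid k_1+\dots+k_n=k,\;k_i\ge2\}$. Then the following two identities hold in $\mathcal{A}$: \[ \sum_{(k_1,\dots,k_n)\in I_{k,n,i}}\zeta_{\mathcal{A}}(k_1,\dots,k_n)=(-1)^{i-1}\biggl(\binom{k-1}{i-1}+(-1)^n\binom{k-1}{n-i}\biggr)\frac{B_{p-k}}{k}, \] \[ \sum_{(k_1,\dots,k_n)\in I_{k,n,i}}\zeta_{\mathcal{A}}^{\star}(k_1,\dots,k_n)=(-1)^{i-1}\biggl((-1)^n\binom{k-1}{i-1}+\binom{k-1}{n-i}\biggr)\frac{B_{p-k}}{k}. \]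
   Context: Let $\mathcal{A}=\bigl(\prod_{p}\mathbb{Z}/p\mathbb{Z}\bigr)/\bigl(\bigoplus_{p}\mathbb{Z}/p\mathbb{Z}\bigr)$, where $p$ runs over all primes. Elements of $\mathcal{A}$ are represented by families $(a_p)_p$ with $a_p\in\mathbb{Z}/p\mathbb{Z}$, and $(a_p)_p=(b_p)_p$ in $\mathcal{A}$ if and only if $a_p=b_p$ for all but finitely many primes $p$; the element $(a_p)_p$ is written simply $a_p$. In particular it suffices to specify $a_p$ for all sufficiently large $p$. For $k_1,\dots,k_n\in\mathbb{Z}_{\ge1}$, the finite multiple zeta value and finite multiple zeta-star value are \[ \zeta_{\mathcal{A}}(k_1,\dots,k_n)=\sum_{p>m_1>\dots>m_n\ge1}\frac{1}{m_1^{k_1}\dotsm m_n^{k_n}}\in\mathcal{A},\qquad \zeta_{\mathcal{A}}^{\star}(k_1,\dots,k_n)=\sum_{p>m_1\ge\dots\ge m_n\ge1}\frac{1}{m_1^{k_1}\dotsm m_n^{k_n}}\in\mathcal{A}, \] where the $p$-component is the given sum over integers $m_1,\dots,m_n$, computed in $\mathbb{Z}/p\mathbb{Z}$. The Bernoulli numbers $B_m\in\mathbb{Q}$ are given by $\sum_{m=0}^{\infty}B_m\frac{x^m}{m!}=\frac{x}{1-e^{-x}}\in\mathbb{Q}[[x]]$. The expression $\frac{B_{p-k}}{k}$ denotes the element of $\mathcal{A}$ whose $p$-component, for all sufficiently large primes $p$, is the reduction modulo $p$ of the ($p$-integral) rational number $B_{p-k}/k$. *)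

theory Defs
  imports
    "HOL-Computational_Algebra.Computational_Algebra"
    "HOL-Number_Theory.Number_Theory"
begin

section \<open>The ring \<open>\<A>\<close>\<close>

text \<open>
  \<open>\<A>\<close> is the product of all prime fields \<open>\<int>/p\<int>\<close> modulo their direct sum. A family with components
  in \<open>\<int>/p\<int>\<close> is given by integer representatives, so an integer family \<open>a\<close> stands for
  \<open>(a p mod p)\<^sub>p\<close>; its values at non-prime indices are ignored. Two families represent the same
  element iff their components agree in \<open>\<int>/p\<int>\<close> for all but finitely many primes \<open>p\<close>.
\<close>

definition eq_almost_all :: "(nat \<Rightarrow> int) \<Rightarrow> (nat \<Rightarrow> int) \<Rightarrow> bool" where
  "eq_almost_all a b \<longleftrightarrow> finite {p. prime p \<and> \<not> [a p = b p] (mod int p)}"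

lemma eq_almost_allI:
  assumes "eq_almost_all a b" "eq_almost_all c d"
    and "\<And>p. prime p \<Longrightarrow> [a p = b p] (mod int p) \<Longrightarrow> [c p = d p] (mod int p) \<Longrightarrow>
          [e p = f p] (mod int p)"
  shows "eq_almost_all e f"
proof -
  have "{p. prime p \<and> \<not> [e p = f p] (mod int p)} \<subseteq>
        {p. prime p \<and> \<not> [a p = b p] (mod int p)} \<union> {p. prime p \<and> \<not> [c p = d p] (mod int p)}"
    using assms(3) by blast
  then show ?thesis
    using assms(1,2) unfolding eq_almost_all_def by (meson finite_UnI finite_subset)
qed

lemma eq_almost_all_refl: "eq_almost_all a a"
  by (simp add: eq_almost_all_def)

quotient_type ring_A = "nat \<Rightarrow> int" / eq_almost_all
proof (rule equivpI)
  show "reflp eq_almost_all"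
    by (rule reflpI) (rule eq_almost_all_refl)
  show "symp eq_almost_all"
    by (rule sympI) (erule eq_almost_allI[OF _ eq_almost_all_refl], rule cong_sym)
  show "transp eq_almost_all"
    by (rule transpI) (erule (1) eq_almost_allI, rule cong_trans)
qed

instantiation ring_A :: comm_ring_1
begin

lift_definition zero_ring_A :: ring_A is "\<lambda>p. 0" .

lift_definition one_ring_A :: ring_A is "\<lambda>p. 1" .

lift_definition plus_ring_A :: "ring_A \<Rightarrow> ring_A \<Rightarrow> ring_A" is "\<lambda>a b p. a p + b p"
  by (erule (1) eq_almost_allI) (rule cong_add)

lift_definition minus_ring_A :: "ring_A \<Rightarrow> ring_A \<Rightarrow> ring_A" is "\<lambda>a b p. a p - b p"
  by (erule (1) eq_almost_allI) (rule cong_diff)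

lift_definition uminus_ring_A :: "ring_A \<Rightarrow> ring_A" is "\<lambda>a p. - a p"
  by (erule eq_almost_allI[OF _ eq_almost_all_refl]) (simp add: cong_minus_minus_iff)

lift_definition times_ring_A :: "ring_A \<Rightarrow> ring_A \<Rightarrow> ring_A" is "\<lambda>a b p. a p * b p"
  by (erule (1) eq_almost_allI) (rule cong_mult)

instance
proof
  have "{p::nat. prime p \<and> \<not> [0 = 1] (mod int p)} = {p. prime p}"
    by (auto simp: cong_def dest: prime_gt_1_nat)
  then show "(0 :: ring_A) \<noteq> 1"
    by transfer (auto simp: eq_almost_all_def primes_infinite)
qed (transfer; simp add: algebra_simps eq_almost_all_refl)+

end

text \<open>The element \<open>(a\<^sub>p)\<^sub>p\<close> of \<open>\<A>\<close>.\<close>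

lift_definition elem_A :: "(nat \<Rightarrow> int) \<Rightarrow> ring_A" is "\<lambda>a. a" .

lemma elem_A_eq_iff:
  "elem_A a = elem_A b \<longleftrightarrow> finite {p. prime p \<and> \<not> [a p = b p] (mod int p)}"
  by transfer (simp add: eq_almost_all_def)


section \<open>Finite multiple zeta(-star) values\<close>

text \<open>
  An index \<open>(k\<^sub>1,\<dots>,k\<^sub>n)\<close> is the list \<open>ks\<close> with \<open>k\<^sub>j = ks ! (j - 1)\<close>, and likewise for the
  summation variables \<open>(m\<^sub>1,\<dots>,m\<^sub>n)\<close>. For \<open>0 < m < p\<close> the inverse in \<open>\<int>/p\<int>\<close> is
  \<^const>\<open>modular_inverse\<close>.
\<close>

definition zeta_A :: "nat list \<Rightarrow> ring_A" where
  "zeta_A ks = elem_A (\<lambda>p.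
     \<Sum>ms | length ms = length ks \<and> set ms \<subseteq> {1..<p} \<and> sorted_wrt (>) ms.
       modular_inverse (int p) (\<Prod>j<length ks. int (ms ! j) ^ (ks ! j)))"

definition zeta_star_A :: "nat list \<Rightarrow> ring_A" where
  "zeta_star_A ks = elem_A (\<lambda>p.
     \<Sum>ms | length ms = length ks \<and> set ms \<subseteq> {1..<p} \<and> sorted_wrt (\<ge>) ms.
       modular_inverse (int p) (\<Prod>j<length ks. int (ms ! j) ^ (ks ! j)))"

definition index_set :: "nat \<Rightarrow> nat \<Rightarrow> nat \<Rightarrow> nat list set" where
  "index_set k n i =
     {ks. length ks = n \<and> (\<forall>x\<in>set ks. 1 \<le> x) \<and> sum_list ks = k \<and> 2 \<le> ks ! (i - 1)}"

lemma finite_summation_lists: "finite {ms. length ms = n \<and> set ms \<subseteq> {1..<p::nat} \<and> P ms}"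
  by (rule finite_subset[OF _ finite_lists_length_eq[of "{1..<p}" n]]) auto

lemma finite_index_set: "finite (index_set k n i)"
  by (rule finite_subset[OF _ finite_lists_length_eq[of "{..k}" n]])
     (auto simp: index_set_def dest: member_le_sum_list)


section \<open>Bernoulli numbers\<close>

text \<open>This is the convention with \<open>B\<^sub>1 = 1/2\<close>.\<close>

definition bernoulli :: "nat \<Rightarrow> rat" where
  "bernoulli m = fact m * fps_nth (fps_X / (1 - fps_exp (- 1))) m"

text \<open>
  Reduction modulo \<open>p\<close> of a \<open>p\<close>-integral rational. If \<open>p\<close> divides the denominator, the value is
  the irrelevant \<open>0\<close>.
\<close>

definition reduce_mod :: "nat \<Rightarrow> rat \<Rightarrow> int" where
  "reduce_mod p q = (case quotient_of q of (a, b) \<Rightarrow> a * modular_inverse (int p) b mod int p)"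

text \<open>
  The element \<open>B\<^bsub>p-k\<^esub>/k\<close>. The truncated subtraction only affects the finitely many primes
  \<open>p < k\<close>.
\<close>

definition bernoulli_A :: "nat \<Rightarrow> ring_A" where
  "bernoulli_A k = elem_A (\<lambda>p. reduce_mod p (bernoulli (p - k) / of_nat k))"

end

(*
  Summing x^k / m^k over all exponents turns the sum over indices into the coefficient of x^k in
    G = sum_m x^2 / (m (m - x)) e_(i-1)(x / (l - x) : l > m) e_(n-i)(x / (l - x) : l < m),
  and for the star values the same with complete homogeneous instead of elementary symmetric sums.
  Modulo p, the product of all l - x with 0 < l < p is -1 up to order x^(p-1). Multiplying G by it
  leaves the coefficients u_(a,b) (middle_coeff below) of the polynomial
    U(s, t) = sum_m 1/m * prod_(l > m) (l + s) * prod_(l < m) (l + t).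
  For 0 < x, y < p one has U(-x, -y) = 1 / (x y) if x <= y and 0 otherwise, so that u_(a,b) is, up to
  sign, the double power sum of x^(-a-1) y^(-b-1) over x <= y, a multiple of B_(p-k) by Faulhaber's
  formula. The remaining binomial sum is a k-th finite difference of a polynomial of degree < k.
  In the star case, the elementary symmetric sums of all x / (l - x) vanish modulo p, so complete
  homogeneous sums over l >= m become elementary symmetric sums over l < m: star values for i reduce
  to non-star values for n + 1 - i.
*)

theory Submission
  imports Defs
begin

section \<open>Rationals modulo a prime\<close>

text \<open>The coefficients u_(a,b) have no convenient closed form, but the values U(-x, -y) do:
  the summands with m < x or m > y vanish, and the others add up by a partial fraction identity.
  Coefficients are recovered from values because the sum of x^(p - 1 - j) f(x) over 0 < x < p is
  congruent to minus the coefficient of x^j in f. Power sums see exponents only modulo p - 1, so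
  degrees have to stay below p - 1, or the exponents 0 and p - 1 need separate care. All sums are
  formed over the rationals, where Faulhaber's formula and the identities for factorials and
  binomials are exact; reduction modulo p enters as a congruence between rationals, at the price of
  p-integrality conditions on products. The two binomial coefficients of the result are the two end
  terms of the k-th finite difference. Their relative sign comes out right for odd k; for even k the
  Bernoulli number vanishes.\<close>

definition p_integral :: "nat \<Rightarrow> rat \<Rightarrow> bool" where
  "p_integral p x \<longleftrightarrow> (\<exists>a b. \<not> int p dvd b \<and> x = of_int a / of_int b)"

text \<open>For prime \<open>p\<close> this is congruence modulo the maximal ideal of the
  localization of the integers at \<open>p\<close>. Neither \<open>x\<close> nor \<open>y\<close>
  has to be p-integral, so integrality is asked for only where something is multiplied.\<close>

definition cong_rat :: "nat \<Rightarrow> rat \<Rightarrow> rat \<Rightarrow> bool" where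
  "cong_rat p x y \<longleftrightarrow> (\<exists>z. p_integral p z \<and> x - y = of_nat p * z)"

locale prime_modulus =
  fixes p :: nat
  assumes prime_p: "prime p"
begin

abbreviation pint :: "rat \<Rightarrow> bool" where
  "pint \<equiv> p_integral p"

abbreviation pcong :: "rat \<Rightarrow> rat \<Rightarrow> bool" (infix "\<equiv>\<^sub>p" 50) where
  "x \<equiv>\<^sub>p y \<equiv> cong_rat p x y"

lemma prime_int_p: "prime (int p)"
  using prime_p by simp

lemma pint_of_int [simp, intro]: "pint (of_int a)"
  unfolding p_integral_def using prime_int_p
  by (intro exI[of _ a] exI[of _ 1]) (auto simp: not_prime_unit)

lemma pint_of_nat [simp, intro]: "pint (of_nat a)"
  using pint_of_int[of "int a"] by simp

lemma pint_0 [simp, intro]: "pint 0" and pint_1 [simp, intro]: "pint 1"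
  using pint_of_int[of 0] pint_of_int[of 1] by simp_all

lemma pint_add [intro]:
  assumes "pint x" "pint y"
  shows "pint (x + y)"
proof -
  obtain a b c d where *: "\<not> int p dvd b" "x = of_int a / of_int b"
      "\<not> int p dvd d" "y = of_int c / of_int d"
    using assms unfolding p_integral_def by blast
  have "b \<noteq> 0" "d \<noteq> 0" using * by auto
  then have "x + y = of_int (a * d + c * b) / of_int (b * d)"
    using * by (simp add: field_simps)
  moreover have "\<not> int p dvd b * d"
    using * prime_int_p by (simp add: prime_dvd_mult_iff)
  ultimately show ?thesis unfolding p_integral_def by blast
qed

lemma pint_mult [intro]:
  assumes "pint x" "pint y"
  shows "pint (x * y)"
proof -
  obtain a b c d where *: "\<not> int p dvd b" "x = of_int a / of_int b"
      "\<not> int p dvd d" "y = of_int c / of_int d"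
    using assms unfolding p_integral_def by blast
  have "x * y = of_int (a * c) / of_int (b * d)"
    using * by (simp add: field_simps)
  moreover have "\<not> int p dvd b * d"
    using * prime_int_p by (simp add: prime_dvd_mult_iff)
  ultimately show ?thesis unfolding p_integral_def by blast
qed

lemma pint_uminus [intro]: "pint x \<Longrightarrow> pint (- x)"
  using pint_mult[of "-1" x] pint_of_int[of "-1"] by simp

lemma pint_diff [intro]: "pint x \<Longrightarrow> pint y \<Longrightarrow> pint (x - y)"
  using pint_add[of x "- y"] by auto

lemma pint_power [intro]: "pint x \<Longrightarrow> pint (x ^ n)"
  by (induction n) auto

lemma pint_sum [intro]: "(\<And>x. x \<in> A \<Longrightarrow> pint (f x)) \<Longrightarrow> pint (sum f A)"
  by (induction A rule: infinite_finite_induct) auto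

lemma pint_prod [intro]: "(\<And>x. x \<in> A \<Longrightarrow> pint (f x)) \<Longrightarrow> pint (prod f A)"
  by (induction A rule: infinite_finite_induct) auto

lemma pint_inverse:
  assumes "\<not> int p dvd b"
  shows "pint (1 / of_int b)"
  unfolding p_integral_def using assms by (metis of_int_1)

lemma pint_inverse_nat:
  assumes "0 < m" "m < p"
  shows "pint (1 / of_nat m)"
  using pint_inverse[of "int m"] assms by (simp add: nat_dvd_not_less)

lemma pint_divide_nat: "pint x \<Longrightarrow> 0 < m \<Longrightarrow> m < p \<Longrightarrow> pint (x / of_nat m)"
  using pint_mult[OF _ pint_inverse_nat, of x m] by simp

lemma pcong_refl [simp, intro]: "x \<equiv>\<^sub>p x"
  unfolding cong_rat_def by (intro exI[of _ 0]) auto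

lemma pcong_sym: "x \<equiv>\<^sub>p y \<Longrightarrow> y \<equiv>\<^sub>p x"
  unfolding cong_rat_def by (metis minus_diff_eq mult_minus_right pint_uminus)

lemma pcong_add:
  assumes "a \<equiv>\<^sub>p b" "c \<equiv>\<^sub>p d"
  shows "a + c \<equiv>\<^sub>p b + d"
proof -
  obtain y z where "pint y" "a - b = of_nat p * y" "pint z" "c - d = of_nat p * z"
    using assms unfolding cong_rat_def by blast
  then show ?thesis unfolding cong_rat_def
    by (intro exI[of _ "y + z"]) (auto simp: algebra_simps)
qed

lemma pcong_trans [trans]: "x \<equiv>\<^sub>p y \<Longrightarrow> y \<equiv>\<^sub>p z \<Longrightarrow> x \<equiv>\<^sub>p z"
  using pcong_add[of x y y z] unfolding cong_rat_def by simp

lemma pcong_scale: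
  assumes "pint c" "a \<equiv>\<^sub>p b"
  shows "c * a \<equiv>\<^sub>p c * b"
proof -
  obtain y where "pint y" "a - b = of_nat p * y"
    using assms unfolding cong_rat_def by blast
  then show ?thesis unfolding cong_rat_def using assms(1)
    by (intro exI[of _ "c * y"]) (auto simp: algebra_simps)
qed

lemma pcong_minus: "a \<equiv>\<^sub>p b \<Longrightarrow> - a \<equiv>\<^sub>p - b"
  using pcong_scale[of "-1" a b] pint_of_int[of "-1"] by simp

lemma pcong_diff: "a \<equiv>\<^sub>p b \<Longrightarrow> c \<equiv>\<^sub>p d \<Longrightarrow> a - c \<equiv>\<^sub>p b - d"
  using pcong_add[of a b "- c" "- d"] pcong_minus by simp

text \<open>From a c - b d = c (a - b) + b (c - d); hence the integrality of just \<open>b\<close>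
  and \<open>c\<close>.\<close>

lemma pcong_mult:
  assumes "a \<equiv>\<^sub>p b" "c \<equiv>\<^sub>p d" "pint b" "pint c"
  shows "a * c \<equiv>\<^sub>p b * d"
  using pcong_scale[OF assms(4,1)] pcong_scale[OF assms(3,2)]
  by (auto simp: mult.commute intro: pcong_trans)

lemma pcong_sum: "(\<And>x. x \<in> A \<Longrightarrow> f x \<equiv>\<^sub>p g x) \<Longrightarrow> sum f A \<equiv>\<^sub>p sum g A"
  by (induction A rule: infinite_finite_induct) (auto intro: pcong_add)

lemma pcong_prod:
  "(\<And>x. x \<in> A \<Longrightarrow> f x \<equiv>\<^sub>p g x) \<Longrightarrow> (\<And>x. x \<in> A \<Longrightarrow> pint (f x)) \<Longrightarrow>
    (\<And>x. x \<in> A \<Longrightarrow> pint (g x)) \<Longrightarrow> prod f A \<equiv>\<^sub>p prod g A"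
  by (induction A rule: infinite_finite_induct) (auto intro!: pcong_mult)

lemma pcong_0_mult: "pint x \<Longrightarrow> of_nat p * x \<equiv>\<^sub>p 0"
  unfolding cong_rat_def by auto

lemma pcong_cancel:
  assumes "c * a \<equiv>\<^sub>p c * b" "pint (1 / c)" "c \<noteq> 0"
  shows "a \<equiv>\<^sub>p b"
  using pcong_scale[OF assms(2,1)] assms(3) by simp

lemma pcong_of_int_iff: "of_int a \<equiv>\<^sub>p of_int b \<longleftrightarrow> [a = b] (mod int p)"
proof
  assume "of_int a \<equiv>\<^sub>p of_int b"
  then obtain c d where *: "\<not> int p dvd d" "of_int a - of_int b = of_nat p * (of_int c / of_int d :: rat)"
    unfolding cong_rat_def p_integral_def by blast
  have "d \<noteq> 0" using * by auto
  then have "of_int ((a - b) * d) = (of_int (int p * c) :: rat)"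
    using * by (simp add: field_simps)
  then have "(a - b) * d = int p * c"
    by (simp only: of_int_eq_iff)
  then have "int p dvd (a - b) * d" by simp
  then show "[a = b] (mod int p)"
    using * prime_int_p by (simp add: prime_dvd_mult_iff cong_iff_dvd_diff)
next
  assume "[a = b] (mod int p)"
  then obtain c where "a - b = int p * c"
    by (auto simp: cong_iff_dvd_diff)
  then have "of_int a - of_int b = of_nat p * (of_int c :: rat)"
    by (metis of_int_diff of_int_mult of_int_of_nat_eq)
  then show "of_int a \<equiv>\<^sub>p of_int b"
    unfolding cong_rat_def by auto
qed

lemma pcong_modular_inverse:
  assumes "\<not> int p dvd b"
  shows "of_int (modular_inverse (int p) b) \<equiv>\<^sub>p 1 / of_int b"
proof (rule pcong_cancel)
  have "coprime b (int p)"
    using assms prime_int_p by (meson coprime_commute prime_imp_coprime)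
  then have "[b * modular_inverse (int p) b = 1] (mod int p)"
    by (rule cong_modular_inverse1)
  then have "of_int (b * modular_inverse (int p) b) \<equiv>\<^sub>p of_int 1"
    by (simp only: pcong_of_int_iff)
  then show "of_int b * of_int (modular_inverse (int p) b) \<equiv>\<^sub>p of_int b * (1 / of_int b)"
    using assms by (cases "b = 0") auto
  show "pint (1 / of_int b)" by (rule pint_inverse) fact
  show "(of_int b :: rat) \<noteq> 0" using assms by auto
qed

lemma pcong_reduce_mod:
  assumes "pint x"
  shows "of_int (reduce_mod p x) \<equiv>\<^sub>p x"
proof -
  obtain a b where ab: "quotient_of x = (a, b)" by fastforce
  obtain c d where *: "\<not> int p dvd d" "x = of_int c / of_int d"
    using assms unfolding p_integral_def by blast
  have x: "x = of_int a / of_int b" and "coprime a b" "b > 0"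
    using ab quotient_of_div quotient_of_coprime quotient_of_denom_pos by auto
  moreover have "d \<noteq> 0" using * by auto
  ultimately have "of_int (a * d) = (of_int (c * b) :: rat)"
    using * by (simp add: field_simps)
  then have "a * d = c * b" by (simp only: of_int_eq_iff)
  then have "b dvd a * d" by simp
  \<comment> \<open>The denominator in lowest terms divides every other one, so \<open>p\<close>
    does not divide it and the default value of \<open>reduce_mod\<close> does not occur.\<close>
  then have "b dvd d"
    using \<open>coprime a b\<close> by (simp add: coprime_commute coprime_dvd_mult_right_iff)
  then have b: "\<not> int p dvd b"
    using * by (meson dvd_trans)
  have "reduce_mod p x = a * modular_inverse (int p) b mod int p"
    by (simp add: reduce_mod_def ab)
  then have "of_int (reduce_mod p x) \<equiv>\<^sub>p of_int (a * modular_inverse (int p) b)"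
    by (subst pcong_of_int_iff) (simp add: cong_def)
  also have "\<dots> = of_int a * of_int (modular_inverse (int p) b)" by simp
  also have "\<dots> \<equiv>\<^sub>p of_int a * (1 / of_int b)"
    by (intro pcong_scale pcong_modular_inverse b) auto
  finally show ?thesis using x by simp
qed

end

section \<open>Bernoulli numbers and power sums\<close>

definition bernoulli_fps :: "rat fps" where
  "bernoulli_fps = fps_X / (1 - fps_exp (- 1))"

lemma bernoulli_eq_nth: "bernoulli m = fact m * fps_nth bernoulli_fps m"
  by (simp add: bernoulli_def bernoulli_fps_def)

lemma bernoulli_fps_mult: "bernoulli_fps * (1 - fps_exp (- 1)) = fps_X"
proof -
  \<comment> \<open>Division of power series is exact only if the divisor does not have the larger
    subdegree; here both are 1.\<close>
  have "subdegree (1 - fps_exp (- 1) :: rat fps) = 1"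
    by (rule subdegreeI) auto
  moreover from this have "1 - fps_exp (- 1) \<noteq> (0 :: rat fps)"
    by (metis subdegree_0 zero_neq_one)
  ultimately have "1 - fps_exp (- 1) dvd (fps_X :: rat fps)"
    by (subst fps_dvd_iff) auto
  then show ?thesis
    unfolding bernoulli_fps_def by (rule dvd_div_mult_self)
qed

text \<open>The generating series satisfies B(X) - B(-X) = X / (1 - e^(-X)) + X / (1 - e^X) = X, so
  its only odd coefficient is that of X.\<close>

lemma bernoulli_odd_eq_0:
  assumes "odd m" "m > 1"
  shows "bernoulli m = 0"
proof -
  define B' where "B' = fps_compose bernoulli_fps (- fps_X)"
  let ?e = "fps_exp 1 :: rat fps" and ?e' = "fps_exp (- 1) :: rat fps"
  have ee: "?e * ?e' = 1"
    by (simp flip: fps_exp_add_mult)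
  have "fps_compose (bernoulli_fps * (1 - ?e')) (- fps_X) = - fps_X"
    by (simp add: bernoulli_fps_mult)
  then have B': "B' * (1 - ?e) = - fps_X"
    by (simp add: B'_def fps_compose_mult_distrib fps_compose_sub_distrib)
  have ne: "1 - ?e \<noteq> 0" "1 - ?e' \<noteq> 0"
    by (auto simp: fps_eq_iff intro!: exI[of _ 1])
  have "(bernoulli_fps - B') * ((1 - ?e) * (1 - ?e')) =
      (bernoulli_fps * (1 - ?e')) * (1 - ?e) - (B' * (1 - ?e)) * (1 - ?e')"
    by (simp add: algebra_simps)
  also have "\<dots> = fps_X * (1 - ?e) + fps_X * (1 - ?e')"
    by (simp add: bernoulli_fps_mult B')
  also have "\<dots> = fps_X * ((1 - ?e) * (1 - ?e'))"
    using ee by (simp add: algebra_simps)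
  finally have "bernoulli_fps - B' = fps_X"
    using ne by simp
  then have "fps_nth (bernoulli_fps - B') m = fps_nth fps_X m"
    by simp
  then have "fps_nth bernoulli_fps m = 0"
    using assms by (simp add: B'_def fps_compose_uminus')
  then show ?thesis by (simp add: bernoulli_eq_nth)
qed

text \<open>Faulhaber's formula; the convention B_1 = 1/2 makes the sum include b^q. The geometric
  sum (1 - e^(-X)) (e^X + ... + e^(b X)) = e^(b X) - 1 is multiplied by the Bernoulli series, and
  the coefficients of X^(q + 1) are compared.\<close>

lemma sum_powers_bernoulli:
  "(\<Sum>a = 1..b. of_nat a ^ q) =
    (\<Sum>a = 1..q + 1. of_nat ((q + 1) choose a) * bernoulli (q + 1 - a) / of_nat (q + 1) * of_nat b ^ a)"
proof -
  have "(1 - fps_exp (- 1)) * (\<Sum>a = 1..b. fps_exp (of_nat a)) = fps_exp (of_nat b) - (1 :: rat fps)"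
  proof (induction b)
    case (Suc b)
    have "fps_exp (- 1) * fps_exp (of_nat (Suc b)) = (fps_exp (of_nat b) :: rat fps)"
      by (simp flip: fps_exp_add_mult)
    with Suc show ?case by (simp add: algebra_simps)
  qed auto
  then have "bernoulli_fps * (1 - fps_exp (- 1)) * (\<Sum>a = 1..b. fps_exp (of_nat a)) =
      bernoulli_fps * (fps_exp (of_nat b) - 1)"
    by (simp only: mult.assoc)
  then have "fps_nth (fps_X * (\<Sum>a = 1..b. fps_exp (of_nat a))) (Suc q) =
      fps_nth ((fps_exp (of_nat b) - 1) * bernoulli_fps) (Suc q)"
    by (simp only: bernoulli_fps_mult mult.commute)
  moreover have "fps_nth (fps_X * (\<Sum>a = 1..b. fps_exp (of_nat a :: rat))) (Suc q) =
      (\<Sum>a = 1..b. of_nat a ^ q / fact q)"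
    by (simp add: fps_sum_nth)
  ultimately have "(\<Sum>a = 1..b. of_nat a ^ q / fact q) =
      (\<Sum>a = 0..q + 1. fps_nth (fps_exp (of_nat b) - 1) a * fps_nth bernoulli_fps (q + 1 - a))"
    by (simp only: fps_mult_nth Suc_eq_plus1)
  also have "\<dots> = (\<Sum>a = 1..q + 1. fps_nth (fps_exp (of_nat b) - 1) a * fps_nth bernoulli_fps (q + 1 - a))"
    by (rule sum.mono_neutral_right) (auto simp: not_le)
  also have "\<dots> = (\<Sum>a = 1..q + 1. of_nat b ^ a / fact a * (bernoulli (q + 1 - a) / fact (q + 1 - a)))"
    by (intro sum.cong) (auto simp: bernoulli_eq_nth)
  finally have *: "(\<Sum>a = 1..b. of_nat a ^ q / fact q) =
     (\<Sum>a = 1..q + 1. of_nat b ^ a / fact a * (bernoulli (q + 1 - a) / fact (q + 1 - a)))" .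
  have "(\<Sum>a = 1..b. of_nat a ^ q) = fact q * (\<Sum>a = 1..b. of_nat a ^ q / fact q :: rat)"
    by (simp add: sum_distrib_left)
  also have "\<dots> = (\<Sum>a = 1..q + 1.
      fact q * (of_nat b ^ a / fact a * (bernoulli (q + 1 - a) / fact (q + 1 - a))))"
    unfolding * by (rule sum_distrib_left)
  also have "\<dots> = (\<Sum>a = 1..q + 1.
      of_nat ((q + 1) choose a) * bernoulli (q + 1 - a) / of_nat (q + 1) * of_nat b ^ a)"
  proof (rule sum.cong)
    fix a assume "a \<in> {1..q + 1}"
    then show "fact q * (of_nat b ^ a / fact a * (bernoulli (q + 1 - a) / fact (q + 1 - a))) =
        of_nat ((q + 1) choose a) * bernoulli (q + 1 - a) / of_nat (q + 1) * of_nat b ^ a"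
      using binomial_fact[of a "q + 1", where ?'a = rat]
      by (simp add: field_simps del: of_nat_Suc)
  qed auto
  finally show ?thesis .
qed

section \<open>Bernoulli numbers and power sums modulo p\<close>

context prime_modulus
begin

text \<open>Faulhaber's formula at b = 1 is a recurrence whose only denominator is m + 1 < p. The
  bound is sharp: by von Staudt-Clausen, \<open>p\<close> divides the denominator of
  B_(p-1).\<close>

lemma pint_bernoulli: "m + 2 \<le> p \<Longrightarrow> pint (bernoulli m)"
proof (induction m rule: less_induct)
  case (less m)
  let ?t = "\<lambda>a. of_nat ((m + 1) choose a) * bernoulli (m + 1 - a)"
  have "(1 :: rat) = (\<Sum>a = 1..m + 1. ?t a / of_nat (m + 1))"
    using sum_powers_bernoulli[of m 1] by simp
  then have "of_nat (m + 1) = (\<Sum>a = 1..m + 1. ?t a)"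
    by (simp add: field_simps flip: sum_divide_distrib del: sum.cl_ivl_Suc)
  also have "\<dots> = of_nat (m + 1) * bernoulli m + (\<Sum>a = 2..m + 1. ?t a)"
    by (subst sum.atLeast_Suc_atMost) (auto simp: numeral_2_eq_2 del: sum.cl_ivl_Suc)
  finally have "of_nat (m + 1) * bernoulli m = of_nat (m + 1) - (\<Sum>a = 2..m + 1. ?t a)"
    by (simp only: algebra_simps)
  moreover have "(of_nat (m + 1) :: rat) \<noteq> 0"
    by (simp only: of_nat_eq_0_iff)
  ultimately have "bernoulli m = (of_nat (m + 1) - (\<Sum>a = 2..m + 1. ?t a)) / of_nat (m + 1)"
    by (metis nonzero_mult_div_cancel_left)
  moreover have "pint (of_nat (m + 1) - (\<Sum>a = 2..m + 1. ?t a))"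
    using less by (intro pint_diff pint_sum pint_mult pint_of_nat) auto
  ultimately show ?case
    using less.prems by (simp only:) (rule pint_divide_nat, auto)
qed

lemma fermat_pcong:
  assumes "0 < a" "a < p"
  shows "of_nat a ^ (p - 1) \<equiv>\<^sub>p 1"
proof -
  have "[a ^ (p - 1) = 1] (mod p)"
    using assms prime_p by (intro fermat_theorem) (auto simp: nat_dvd_not_less)
  then have "[int (a ^ (p - 1)) = int 1] (mod int p)"
    by (simp only: cong_int_iff)
  then show ?thesis
    by (simp flip: pcong_of_int_iff)
qed

text \<open>Fermat's theorem reduces \<open>e\<close> to q = e mod (p - 1). For q > 0 every term of
  Faulhaber's formula at b = p has a factor \<open>p\<close>, and the coefficients are p-integral
  because q is at most p - 2.\<close>

lemma power_sum_pcong: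
  "(\<Sum>a = 1..<p. of_nat a ^ e) \<equiv>\<^sub>p (if (p - 1) dvd e then - 1 else 0)"
proof -
  define q where "q = e mod (p - 1)"
  have p: "p \<ge> 2" using prime_p by (rule prime_ge_2_nat)
  then have q: "q \<le> p - 2"
    unfolding q_def using mod_less_divisor[of "p - 1" e] by linarith
  have "of_nat a ^ e \<equiv>\<^sub>p of_nat a ^ q" if "a \<in> {1..<p}" for a
  proof -
    have "of_nat a ^ e = (of_nat a ^ (p - 1)) ^ (e div (p - 1)) * (of_nat a ^ q :: rat)"
      unfolding q_def by (simp flip: power_mult power_add)
    also have "\<dots> = of_nat a ^ q * (\<Prod>i<e div (p - 1). of_nat a ^ (p - 1))"
      by simp
    also have "\<dots> \<equiv>\<^sub>p of_nat a ^ q * (\<Prod>i<e div (p - 1). 1)"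
      using that by (intro pcong_scale pcong_prod fermat_pcong pint_power) auto
    finally show ?thesis by simp
  qed
  then have "(\<Sum>a = 1..<p. of_nat a ^ e) \<equiv>\<^sub>p (\<Sum>a = 1..<p. of_nat a ^ q)"
    by (rule pcong_sum)
  also have "\<dots> \<equiv>\<^sub>p (if q = 0 then - 1 else 0)"
  proof (cases "q = 0")
    case True
    then have "(\<Sum>a = 1..<p. of_nat a ^ q) = - 1 + of_nat p * (1 :: rat)"
      using p by (simp add: of_nat_diff)
    also have "\<dots> \<equiv>\<^sub>p - 1 + 0"
      by (intro pcong_add pcong_0_mult) auto
    finally show ?thesis using True by simp
  next
    case False
    let ?c = "\<lambda>a. of_nat ((q + 1) choose a) * bernoulli (q + 1 - a) / of_nat (q + 1)"
    have c: "pint (?c a)" if "a \<in> {1..q + 1}" for a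
      using that q p False by (intro pint_divide_nat pint_mult pint_of_nat pint_bernoulli) auto
    have "{1..p} = insert p {1..<p}"
      using p by auto
    then have "(\<Sum>a = 1..<p. of_nat a ^ q) = (\<Sum>a = 1..p. of_nat a ^ q) - (of_nat p ^ q :: rat)"
      by simp
    also have "\<dots> = (\<Sum>a = 1..q + 1. of_nat p * (?c a * of_nat p ^ (a - 1))) - of_nat p * of_nat p ^ (q - 1)"
      unfolding sum_powers_bernoulli using False
      by (intro arg_cong2[of _ _ _ _ "(-)"] sum.cong) (auto simp flip: power_Suc simp: power_eq_if)
    also have "\<dots> \<equiv>\<^sub>p (\<Sum>a = 1..q + 1. 0) - 0"
      using c by (intro pcong_diff pcong_sum pcong_0_mult pint_mult pint_power) auto
    finally show ?thesis using False by simp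
  qed
  finally show ?thesis by (simp add: q_def dvd_eq_mod_eq_0)
qed

text \<open>Orthogonality of powers: after exchanging the sums, only a = j gives an exponent
  divisible by p - 1. This reads a coefficient off from the values of a polynomial.\<close>

lemma power_sum_coeff:
  assumes "finite A" "j \<in> A" "\<And>a. a \<in> A \<Longrightarrow> pint (c a)"
    and "\<And>a. a \<in> A \<Longrightarrow> a \<noteq> j \<Longrightarrow> \<not> (p - 1) dvd (p - 1 - j + a)" "j \<le> p - 1"
  shows "(\<Sum>x = 1..<p. of_nat x ^ (p - 1 - j) * (\<Sum>a\<in>A. c a * of_nat x ^ a)) \<equiv>\<^sub>p - c j"
proof -
  have "(\<Sum>x = 1..<p. of_nat x ^ (p - 1 - j) * (\<Sum>a\<in>A. c a * of_nat x ^ a)) =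
      (\<Sum>a\<in>A. c a * (\<Sum>x = 1..<p. of_nat x ^ (p - 1 - j + a)))"
    unfolding sum_distrib_left by (subst sum.swap) (simp add: power_add mult_ac)
  also have "\<dots> \<equiv>\<^sub>p (\<Sum>a\<in>A. c a * (if (p - 1) dvd (p - 1 - j + a) then - 1 else 0))"
    by (intro pcong_sum pcong_scale power_sum_pcong assms)
  also have "\<dots> = (\<Sum>a\<in>A. if a = j then - c j else 0)"
  proof (intro sum.cong refl)
    fix a assume "a \<in> A"
    then show "c a * (if (p - 1) dvd (p - 1 - j + a) then - 1 else 0) = (if a = j then - c j else 0)"
      using assms(4)[of a] le_add_diff_inverse2[OF assms(5)] by (cases "a = j") auto
  qed
  also have "\<dots> = - c j"
    using assms(1,2) by simp
  finally show ?thesis .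
qed

text \<open>The number lies between 0 and 2 (p - 1). The multiple p - 1 would mean a = j; the last
  two hypotheses exclude the ends 2 (p - 1) and 0 of the range.\<close>

lemma not_dvd_shift:
  assumes "a \<le> p - 1" "j \<le> p - 1" "a \<noteq> j" "a < p - 1 \<or> 0 < j" "0 < a \<or> j < p - 1"
  shows "\<not> (p - 1) dvd (p - 1 - j + a)"
proof
  assume "(p - 1) dvd (p - 1 - j + a)"
  then obtain c where c: "p - 1 - j + a = (p - 1) * c" by (elim dvdE)
  have "c \<noteq> 0" using c assms by (intro notI) auto
  moreover have "c \<noteq> 1" using c assms by (intro notI) auto
  ultimately have "c \<ge> 2" by auto
  then have "(p - 1) * 2 \<le> p - 1 - j + a"
    unfolding c by (intro mult_left_mono) auto
  then show False using assms by linarith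
qed

text \<open>Modulo \<open>p\<close> the upper entry is -(m + 1), and (-(m + 1) choose s) = (-1)^s
  ((m + s) choose s). The induction cancels s + 1, a unit because s + 1 < p.\<close>

lemma binomial_neg_pcong:
  "m + s < p \<Longrightarrow> of_nat ((p - 1 - m) choose s) \<equiv>\<^sub>p (- 1) ^ s * of_nat ((m + s) choose s)"
proof (induction s)
  case (Suc s)
  let ?N = "p - 1 - m"
  have "Suc s * (?N choose Suc s) = (?N - s) * (?N choose s)"
    using binomial_absorption[of s ?N] binomial_absorb_comp[of ?N s] by simp
  then have "of_nat (Suc s) * of_nat (?N choose Suc s) = of_nat (?N - s) * (of_nat (?N choose s) :: rat)"
    by (simp only: flip: of_nat_mult)
  also have "of_nat (?N - s) = of_nat p * 1 - (of_nat (m + Suc s) :: rat)"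
    using Suc.prems by (simp add: of_nat_diff)
  also have "(of_nat p * 1 - of_nat (m + Suc s)) * of_nat (?N choose s) \<equiv>\<^sub>p
      (0 - of_nat (m + Suc s)) * ((- 1) ^ s * of_nat ((m + s) choose s))"
    using Suc by (intro pcong_mult pcong_diff pcong_0_mult pint_diff) auto
  also have "\<dots> = of_nat (Suc s) * ((- 1) ^ Suc s * of_nat ((m + Suc s) choose Suc s))"
  proof -
    have "Suc s * ((m + Suc s) choose Suc s) = (m + Suc s) * ((m + s) choose s)"
      using binomial_absorption[of s "m + Suc s"] by simp
    then have "of_nat (Suc s) * of_nat ((m + Suc s) choose Suc s) =
        of_nat (m + Suc s) * (of_nat ((m + s) choose s) :: rat)"
      by (simp only: flip: of_nat_mult)
    then show ?thesis by (simp only: power_Suc) (simp del: of_nat_Suc of_nat_add binomial_Suc_Suc)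
  qed
  finally show ?case
    by (rule pcong_cancel) (use Suc.prems in \<open>auto intro!: pint_inverse_nat simp del: of_nat_Suc\<close>)
qed auto

text \<open>By Fermat's theorem the exponents stand for -(s + 1) and -(r + 1). Faulhaber's formula
  turns the inner sum into a polynomial in y without constant term; the outer sum picks its
  coefficient of y^(s + 1), the one with B_(p-k).\<close>

lemma double_power_sum_pcong:
  assumes k: "k = r + s + 2" "k < p"
  shows "(\<Sum>y = 1..<p. of_nat y ^ (p - 2 - s) * (\<Sum>x = 1..y. of_nat x ^ (p - 2 - r))) \<equiv>\<^sub>p
    (- 1) ^ (s + 1) * of_nat (k choose (r + 1)) * (bernoulli (p - k) / of_nat k)"
proof -
  define q where "q = p - 2 - r"
  let ?c = "\<lambda>a. of_nat ((q + 1) choose a) * bernoulli (q + 1 - a) / of_nat (q + 1)"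
  have c: "pint (?c a)" if "a \<in> {1..q + 1}" for a
    using that k by (intro pint_divide_nat pint_mult pint_of_nat pint_bernoulli) (auto simp: q_def)
  have "(\<Sum>y = 1..<p. of_nat y ^ (p - 2 - s) * (\<Sum>x = 1..y. of_nat x ^ (p - 2 - r))) =
      (\<Sum>y = 1..<p. of_nat y ^ (p - 1 - (s + 1)) * (\<Sum>a = 1..q + 1. ?c a * of_nat y ^ a))"
    unfolding sum_powers_bernoulli q_def by (simp add: numeral_2_eq_2)
  also have "\<dots> \<equiv>\<^sub>p - ?c (s + 1)"
    using k by (intro power_sum_coeff c not_dvd_shift) (auto simp: q_def)
  also have "?c (s + 1) = bernoulli (p - k) / of_nat (s + 1) * of_nat (q choose s)"
  proof -
    have "(s + 1) * ((q + 1) choose (s + 1)) = (q + 1) * (q choose s)"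
      using binomial_absorption[of s "q + 1"] by simp
    then have "of_nat (s + 1) * of_nat ((q + 1) choose (s + 1)) = of_nat (q + 1) * (of_nat (q choose s) :: rat)"
      by (simp only: flip: of_nat_mult)
    moreover have "q + 1 - (s + 1) = p - k" using k by (simp add: q_def)
    ultimately show ?thesis by (simp add: field_simps del: of_nat_Suc of_nat_add)
  qed
  also have "- (bernoulli (p - k) / of_nat (s + 1) * of_nat (q choose s)) \<equiv>\<^sub>p
     - (bernoulli (p - k) / of_nat (s + 1) * ((- 1) ^ s * of_nat ((r + 1 + s) choose s)))"
  proof -
    have "pint (bernoulli (p - k) * (1 / of_nat (s + 1)))"
      using k by (intro pint_mult pint_inverse_nat pint_bernoulli) auto
    moreover have "of_nat (q choose s) \<equiv>\<^sub>p (- 1) ^ s * of_nat ((r + 1 + s) choose s)"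
      using binomial_neg_pcong[of "r + 1" s] k by (simp add: q_def numeral_2_eq_2)
    ultimately show ?thesis by (intro pcong_minus pcong_scale) auto
  qed
  also have "\<dots> = (- 1) ^ (s + 1) * of_nat (k choose (r + 1)) * (bernoulli (p - k) / of_nat k)"
  proof -
    have "(s + 1) * (k choose (s + 1)) = k * ((r + 1 + s) choose s)"
      using binomial_absorption[of s k] k by simp
    moreover have "k choose (s + 1) = k choose (r + 1)"
      using binomial_symmetric[of "s + 1" k] k by simp
    ultimately have "of_nat (s + 1) * of_nat (k choose (r + 1)) = of_nat k * (of_nat ((r + 1 + s) choose s) :: rat)"
      by (metis of_nat_mult)
    then show ?thesis using k(1) by (simp add: field_simps del: of_nat_Suc of_nat_add)
  qed
  finally show ?thesis .
qed

end

section \<open>Sums over chains\<close>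

text \<open>For \<open>(>)\<close> this is the elementary symmetric polynomial of degree
  \<open>r\<close> in the values of \<open>f\<close> on \<open>S\<close>, for \<open>(\<ge>)\<close>
  the complete homogeneous one. Sorted lists match the summation variables of the zeta
  values.\<close>

definition chain_sum :: "(nat \<Rightarrow> nat \<Rightarrow> bool) \<Rightarrow> (nat \<Rightarrow> 'a::comm_ring_1) \<Rightarrow> nat set \<Rightarrow> nat \<Rightarrow> 'a" where
  "chain_sum R f S r =
     (\<Sum>ms | length ms = r \<and> set ms \<subseteq> S \<and> sorted_wrt R ms. \<Prod>m\<leftarrow>ms. f m)"

lemma finite_chains:
  "finite S \<Longrightarrow> finite {ms :: nat list. length ms = r \<and> set ms \<subseteq> S \<and> sorted_wrt R ms}"
  by (rule finite_subset[OF _ finite_lists_length_eq[of S r]]) auto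

lemma chain_sum_0 [simp]: "chain_sum R f S 0 = 1"
proof -
  have "{ms :: nat list. length ms = 0 \<and> set ms \<subseteq> S \<and> sorted_wrt R ms} = {[]}"
    by auto
  then show ?thesis by (simp add: chain_sum_def)
qed

lemma chain_sum_empty [simp]: "chain_sum R f {} (Suc r) = 0"
proof -
  have "{ms :: nat list. length ms = Suc r \<and> set ms \<subseteq> {} \<and> sorted_wrt R ms} = {}"
    by auto
  then show ?thesis unfolding chain_sum_def by (simp only: sum.empty)
qed

text \<open>Lists are reversed. Since \<open>chain_sum_insert\<close> splits off the first entry of
  a chain, this gives access to the last one, and so to a new minimum of \<open>S\<close>.\<close>

lemma chain_sum_conversep: "chain_sum (\<lambda>x y. R y x) f S r = chain_sum R f S r"
  unfolding chain_sum_def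
  by (rule sum.reindex_bij_witness[of _ rev rev])
     (auto simp: sorted_wrt_rev rev_map[symmetric] prod_list.rev)

text \<open>The right summand collects the chains that start with \<open>a\<close>; the set over which they continue
  contains \<open>a\<close> exactly if \<open>R\<close> is reflexive there.\<close>

lemma chain_sum_insert:
  assumes "finite S" "a \<notin> S" "\<And>x. x \<in> S \<Longrightarrow> \<not> R x a"
  shows "chain_sum R f (insert a S) (Suc r) =
    chain_sum R f S (Suc r) + f a * chain_sum R f {x \<in> insert a S. R a x} r"
proof -
  let ?C = "\<lambda>S r. {ms. length ms = r \<and> set ms \<subseteq> S \<and> sorted_wrt R ms}"
  let ?T = "{x \<in> insert a S. R a x}"
  have eq: "?C (insert a S) (Suc r) = ?C S (Suc r) \<union> (#) a ` ?C ?T r"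
  proof (intro equalityI subsetI)
    fix ms assume ms: "ms \<in> ?C (insert a S) (Suc r)"
    then obtain x xs where x: "ms = x # xs" by (cases ms) auto
    show "ms \<in> ?C S (Suc r) \<union> (#) a ` ?C ?T r"
      using ms assms(3) by (cases "x = a") (auto simp: x)
  qed auto
  have "?C S (Suc r) \<inter> (#) a ` ?C ?T r = {}"
    using assms(2) by auto
  moreover have "inj_on ((#) a) (?C ?T r)" by auto
  ultimately show ?thesis
    unfolding chain_sum_def eq using assms(1)
    by (subst sum.union_disjoint)
       (auto simp: sum.reindex sum_distrib_left intro!: finite_imageI finite_chains)
qed

lemma chain_sum_strict_insert_top:
  assumes "finite S" "\<And>x. x \<in> S \<Longrightarrow> x < a"
  shows "chain_sum (>) f (insert a S) (Suc r) = chain_sum (>) f S (Suc r) + f a * chain_sum (>) f S r"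
proof -
  have "{x \<in> insert a S. a > x} = S" using assms by auto
  then show ?thesis
    using chain_sum_insert[of S a "(>)" f r] assms by (auto dest: order.asym)
qed

lemma chain_sum_strict_insert_bot:
  assumes "finite S" "\<And>x. x \<in> S \<Longrightarrow> a < x"
  shows "chain_sum (>) f (insert a S) (Suc r) = chain_sum (>) f S (Suc r) + f a * chain_sum (>) f S r"
proof -
  have "{x \<in> insert a S. a < x} = S" using assms by auto
  then show ?thesis
    using chain_sum_insert[of S a "(<)" f r] assms chain_sum_conversep[of "(>)" f]
    by (auto dest: order.asym)
qed

lemma chain_sum_weak_insert_top:
  assumes "finite S" "\<And>x. x \<in> S \<Longrightarrow> x < a"
  shows "chain_sum (\<ge>) f (insert a S) (Suc r) =
    chain_sum (\<ge>) f S (Suc r) + f a * chain_sum (\<ge>) f (insert a S) r"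
proof -
  have "{x \<in> insert a S. a \<ge> x} = insert a S" using assms by (auto intro: less_imp_le)
  then show ?thesis
    using chain_sum_insert[of S a "(\<ge>)" f r] assms by (auto simp: not_le)
qed

lemma chain_sum_weak_insert_bot:
  assumes "finite S" "\<And>x. x \<in> S \<Longrightarrow> a < x"
  shows "chain_sum (\<ge>) f (insert a S) (Suc r) =
    chain_sum (\<ge>) f S (Suc r) + f a * chain_sum (\<ge>) f (insert a S) r"
proof -
  have "{x \<in> insert a S. a \<le> x} = insert a S" using assms by (auto intro: less_imp_le)
  then show ?thesis
    using chain_sum_insert[of S a "(\<le>)" f r] assms chain_sum_conversep[of "(\<ge>)" f]
    by (auto simp: not_le)
qed

lemma prod_nth_split:
  fixes f g :: "'b \<Rightarrow> 'a::comm_monoid_mult"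
  assumes "r = length us" "n = length us + length vs + 1"
  shows "(\<Prod>j<n. (if j = r then g else f) ((us @ m # vs) ! j)) =
    g m * prod_list (map f us) * prod_list (map f vs)"
proof -
  let ?F = "\<lambda>j. (if j = length us then g else f) ((us @ m # vs) ! j)"
  let ?n = "Suc (length us + length vs)"
  have "prod ?F {..<?n} = prod ?F {0..<length us} * prod ?F {length us..<?n}"
    by (subst prod.atLeastLessThan_concat) (auto simp: lessThan_atLeast0)
  also have "prod ?F {0..<length us} = prod_list (map f us)"
    by (auto simp: prod.list_conv_set_nth nth_append intro!: prod.cong)
  also have "prod ?F {length us..<?n} = g m * prod ?F {Suc (length us)..<?n}"
    by (subst prod.atLeast_Suc_lessThan) auto
  also have "prod ?F {Suc (length us)..<?n} = (\<Prod>j = 0..<length vs. ?F (j + Suc (length us)))"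
    using prod.shift_bounds_nat_ivl[of ?F 0 "Suc (length us)" "length vs"] by (simp add: add_ac)
  also have "\<dots> = prod_list (map f vs)"
    by (auto simp: prod.list_conv_set_nth nth_append intro!: prod.cong)
  finally show ?thesis by (simp add: assms mult_ac del: prod.lessThan_Suc)
qed

text \<open>A chain is cut at position \<open>r\<close>; transitivity lets any chain before
  \<open>m\<close> and any chain after \<open>m\<close> be joined again. The function
  \<open>g\<close> serves the one position whose exponent must be at least 2.\<close>

lemma chain_sum_split:
  fixes f g :: "nat \<Rightarrow> 'a::comm_ring_1"
  assumes "finite S" "transp R" "n = r + s + 1"
  shows "(\<Sum>ms | length ms = n \<and> set ms \<subseteq> S \<and> sorted_wrt R ms.
            \<Prod>j<n. (if j = r then g else f) (ms ! j)) =
    (\<Sum>m\<in>S. g m * chain_sum R f {x \<in> S. R x m} r * chain_sum R f {x \<in> S. R m x} s)"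
proof -
  let ?C = "\<lambda>S r. {ms. length ms = r \<and> set ms \<subseteq> S \<and> sorted_wrt R ms}"
  let ?U = "\<lambda>m. {x \<in> S. R x m}" and ?L = "\<lambda>m. {x \<in> S. R m x}"
  have fin: "finite (?U m)" "finite (?L m)" for m using assms(1) by auto
  have "(\<Sum>m\<in>S. g m * chain_sum R f (?U m) r * chain_sum R f (?L m) s) =
     (\<Sum>m\<in>S. \<Sum>us\<in>?C (?U m) r. \<Sum>vs\<in>?C (?L m) s. g m * prod_list (map f us) * prod_list (map f vs))"
    unfolding chain_sum_def by (simp add: sum_distrib_left sum_distrib_right mult_ac)
  also have "\<dots> = (\<Sum>(m, us, vs)\<in>(SIGMA m:S. ?C (?U m) r \<times> ?C (?L m) s).
      g m * prod_list (map f us) * prod_list (map f vs))"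
    using assms(1) by (simp add: sum.Sigma sum.cartesian_product finite_chains fin)
  also have "\<dots> = (\<Sum>ms\<in>?C S n. \<Prod>j<n. (if j = r then g else f) (ms ! j))"
  proof (rule sum.reindex_bij_witness[of _ "\<lambda>ms. (ms ! r, take r ms, drop (Suc r) ms)"
        "\<lambda>(m, us, vs). us @ m # vs"]; safe?)
    fix m us vs
    assume *: "m \<in> S" "set us \<subseteq> ?U m" "sorted_wrt R us" "r = length us"
      "set vs \<subseteq> ?L m" "sorted_wrt R vs" "s = length vs"
    have "R x y" if "x \<in> set us" "y \<in> set vs" for x y
      using that * assms(2) by (auto dest!: subsetD elim: transpE)
    with * show "sorted_wrt R (us @ m # vs)"
      by (auto simp: sorted_wrt_append)
  next
    fix ms assume ms: "n = length ms" "set ms \<subseteq> S" "sorted_wrt R ms"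
    then have id: "ms = take r ms @ ms ! r # drop (Suc r) ms"
      using assms(3) by (simp add: id_take_nth_drop)
    then have "sorted_wrt R (take r ms @ ms ! r # drop (Suc r) ms)"
      using ms(3) by metis
    then have srt: "\<And>x. x \<in> set (take r ms) \<Longrightarrow> R x (ms ! r)" "\<And>x. x \<in> set (drop (Suc r) ms) \<Longrightarrow> R (ms ! r) x"
      "sorted_wrt R (take r ms)" "sorted_wrt R (drop (Suc r) ms)"
      by (auto simp: sorted_wrt_append)
    show "ms ! r \<in> S" using ms assms(3) by auto
    show "sorted_wrt R (take r ms)" "sorted_wrt R (drop (Suc r) ms)" by fact+
    show "x \<in> S" if "x \<in> set (take r ms)" for x using that ms by (auto dest: in_set_takeD)
    show "x \<in> S" if "x \<in> set (drop (Suc r) ms)" for x using that ms by (auto dest: in_set_dropD)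
    show "R x (ms ! r)" if "x \<in> set (take r ms)" for x by (rule srt) fact
    show "R (ms ! r) x" if "x \<in> set (drop (Suc r) ms)" for x by (rule srt) fact
  qed (use assms(3) in \<open>auto simp: id_take_nth_drop[symmetric] prod_nth_split simp del: prod.lessThan_Suc\<close>)
  finally show ?thesis ..
qed

section \<open>Generating functions\<close>

text \<open>The expansions of \<open>X / (m - X)\<close> and \<open>X\<^sup>2 / (m (m - X))\<close>.\<close>

definition geom1 :: "nat \<Rightarrow> rat fps" where
  "geom1 m = Abs_fps (\<lambda>j. if j < 1 then 0 else 1 / of_nat m ^ j)"

definition geom2 :: "nat \<Rightarrow> rat fps" where
  "geom2 m = Abs_fps (\<lambda>j. if j < 2 then 0 else 1 / of_nat m ^ j)"

definition lin_prod :: "nat set \<Rightarrow> rat fps" where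
  "lin_prod S = (\<Prod>l\<in>S. fps_const (of_nat l) - fps_X)"

definition pos_prod :: "nat set \<Rightarrow> rat poly" where
  "pos_prod S = (\<Prod>l\<in>S. [:of_nat l, 1:])"

lemma geom1_mult: "m > 0 \<Longrightarrow> (fps_const (of_nat m) - fps_X) * geom1 m = fps_X"
  by (rule fps_ext) (auto simp: geom1_def algebra_simps power_eq_if Suc_lessI)

lemma geom2_mult: "m > 0 \<Longrightarrow> (fps_const (of_nat m) - fps_X) * geom2 m = fps_const (1 / of_nat m) * fps_X ^ 2"
  by (rule fps_ext)
     (auto simp: geom2_def algebra_simps power_eq_if fps_X_power_iff power2_eq_square)

text \<open>A subset T of size \<open>r\<close> contributes X^r times the product of l - X over S -
  T: the denominators are gone. To reach X^a, another a - r factors give -X; every subset of size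
  \<open>a\<close> arises \<open>a choose r\<close> times, and the coefficient of
  \<open>pos_prod S\<close> collects the products of the remaining elements.\<close>

lemma lin_prod_chain_sum:
  assumes "finite S" "0 \<notin> S"
  shows "fps_nth (lin_prod S * chain_sum (>) geom1 S r) a = (- 1) ^ (a + r) * of_nat (a choose r) * poly.coeff (pos_prod S) a"
  using assms
proof (induction S arbitrary: r a rule: finite_linorder_max_induct)
  case empty
  show ?case by (cases r; cases a) (auto simp: lin_prod_def pos_prod_def)
next
  case (insert l S)
  let ?E = "chain_sum (>) geom1" and ?e = "fps_const (of_nat l) - fps_X :: rat fps"
  have l: "l > 0" "l \<notin> S" using insert by auto
  have P: "lin_prod (insert l S) = ?e * lin_prod S"
    using insert l by (simp add: lin_prod_def)
  have Q: "pos_prod (insert l S) = Polynomial.smult (of_nat l) (pos_prod S) + pCons 0 (pos_prod S)"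
    using insert l by (simp add: pos_prod_def)
  have IH: "fps_nth (lin_prod S * ?E S r) a = (- 1) ^ (a + r) * of_nat (a choose r) * poly.coeff (pos_prod S) a" for r a
    using insert by simp
  show ?case
  proof (cases r)
    case 0
    have "fps_nth (lin_prod (insert l S) * ?E (insert l S) r) a = fps_nth (?e * (lin_prod S * ?E S 0)) a"
      by (simp add: P 0)
    also have "\<dots> = (- 1) ^ (a + r) * of_nat (a choose r) * poly.coeff (pos_prod (insert l S)) a"
      unfolding left_diff_distrib fps_sub_nth fps_mult_left_const_nth fps_X_mult_nth IH Q
      by (cases a) (auto simp: IH 0 algebra_simps)
    finally show ?thesis .
  next
    case (Suc r')
    have "lin_prod (insert l S) * ?E (insert l S) r =
        ?e * lin_prod S * (?E S (Suc r') + geom1 l * ?E S r')"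
      using insert by (subst P, subst Suc, subst chain_sum_strict_insert_top) auto
    also have "\<dots> = ?e * (lin_prod S * ?E S (Suc r')) + (?e * geom1 l) * (lin_prod S * ?E S r')"
      by (simp add: algebra_simps)
    also have "?e * geom1 l = fps_X" using l by (intro geom1_mult)
    finally have eq: "lin_prod (insert l S) * ?E (insert l S) r =
      ?e * (lin_prod S * ?E S (Suc r')) + fps_X * (lin_prod S * ?E S r')" .
    show ?thesis
      unfolding eq left_diff_distrib fps_sub_nth fps_add_nth fps_mult_left_const_nth fps_X_mult_nth IH Q
      by (cases a) (auto simp: IH Suc algebra_simps)
  qed
qed

section \<open>The middle coefficients\<close>

text \<open>Pascal's rule: a finite difference of order d + 1 is one of order d, applied to the
  first difference.\<close>

lemma alternating_binomial_sum_Suc: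
  fixes f :: "nat \<Rightarrow> 'a::comm_ring_1"
  shows "(\<Sum>j\<le>Suc d. (- 1) ^ j * of_nat (Suc d choose j) * f j) =
    (\<Sum>j\<le>d. (- 1) ^ j * of_nat (d choose j) * (f j - f (Suc j)))"
proof -
  have "(\<Sum>j\<le>Suc d. (- 1) ^ j * of_nat (Suc d choose j) * f j) =
      f 0 + (\<Sum>j\<le>d. (- 1) ^ Suc j * (of_nat (d choose Suc j) + of_nat (d choose j)) * f (Suc j))"
    by (subst sum.atMost_Suc_shift) (simp add: add.commute)
  also have "\<dots> = (f 0 + (\<Sum>j\<le>d. (- 1) ^ Suc j * of_nat (d choose Suc j) * f (Suc j))) -
      (\<Sum>j\<le>d. (- 1) ^ j * of_nat (d choose j) * f (Suc j))"
  proof -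
    have "(- 1) ^ Suc j * (of_nat (d choose Suc j) + of_nat (d choose j)) * f (Suc j) =
        (- 1) ^ Suc j * of_nat (d choose Suc j) * f (Suc j) - (- 1) ^ j * of_nat (d choose j) * f (Suc j)" for j
      by (simp add: algebra_simps)
    then show ?thesis by (simp only: sum_subtractf add_diff_eq)
  qed
  also have "f 0 + (\<Sum>j\<le>d. (- 1) ^ Suc j * of_nat (d choose Suc j) * f (Suc j)) =
      (\<Sum>j\<le>Suc d. (- 1) ^ j * of_nat (d choose j) * f j)"
    by (subst sum.atMost_Suc_shift) simp
  also have "\<dots> = (\<Sum>j\<le>d. (- 1) ^ j * of_nat (d choose j) * f j)"
    by (simp add: binomial_eq_0)
  finally show ?thesis
    by (simp add: sum_subtractf algebra_simps)
qed

text \<open>Both sides are the Beta integral of t^(x - 1) (1 - t)^d over [0, 1]; the proof uses the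
  difference recursion in \<open>d\<close> instead.\<close>

lemma alternating_binomial_sum_inverse:
  "x > 0 \<Longrightarrow> (\<Sum>j\<le>d. (- 1) ^ j * of_nat (d choose j) * (1 / of_nat (x + j))) =
    (fact d * fact (x - 1) / fact (x + d) :: 'a::field_char_0)"
proof (induction d arbitrary: x)
  case 0
  then show ?case by (cases x) auto
next
  case (Suc d)
  have ne: "(1 + of_nat x + of_nat d :: 'a) \<noteq> 0" "(1 + (of_nat x + of_nat d) :: 'a) \<noteq> 0"
    by (metis of_nat_Suc of_nat_add add_Suc add.assoc of_nat_neq_0)+
  obtain x' where x: "x = Suc x'" using Suc.prems by (cases x) auto
  have "(\<Sum>j\<le>Suc d. (- 1) ^ j * of_nat (Suc d choose j) * (1 / of_nat (x + j))) =
      (\<Sum>j\<le>d. (- 1) ^ j * of_nat (d choose j) * (1 / of_nat (x + j))) -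
      (\<Sum>j\<le>d. (- 1) ^ j * of_nat (d choose j) * (1 / of_nat (Suc x + j) :: 'a))"
    by (subst alternating_binomial_sum_Suc) (simp add: algebra_simps sum_subtractf)
  also have "\<dots> = fact d * fact (x - 1) / fact (x + d) - fact d * fact (Suc x - 1) / fact (Suc x + d)"
    using Suc by (simp only: Suc.IH zero_less_Suc)
  also have "\<dots> = (fact d * fact x' * of_nat (Suc (x + d)) - fact d * (of_nat x * fact x')) / fact (Suc (x + d))"
    by (simp add: x fact_Suc[of "Suc (x' + d)"] diff_divide_distrib del: fact_Suc of_nat_Suc) (simp add: fact_Suc)
  also have "fact d * fact x' * of_nat (Suc (x + d)) - fact d * (of_nat x * fact x') =
      (fact (Suc d) * fact (x - 1) :: 'a)"
    by (simp add: x algebra_simps)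
  finally show ?case by simp
qed

lemma poly_eq_sum_bound:
  fixes q :: "'a::comm_ring_1 poly"
  assumes "degree q \<le> n"
  shows "poly q x = (\<Sum>a\<le>n. poly.coeff q a * x ^ a)"
proof -
  have "(\<Sum>a\<le>degree q. poly.coeff q a * x ^ a) = (\<Sum>a\<le>n. poly.coeff q a * x ^ a)"
    using assms by (intro sum.mono_neutral_left) (auto simp: coeff_eq_0)
  then show ?thesis by (simp only: Polynomial.poly_altdef)
qed

section \<open>Values of the polynomial U at negative integers\<close>

lemma poly_pos_prod: "poly (pos_prod S) x = (\<Prod>l\<in>S. of_nat l + x)"
  by (simp add: pos_prod_def poly_prod)

lemma degree_pos_prod: "degree (pos_prod S) \<le> card S"
proof (induction S rule: infinite_finite_induct)
  case (insert l S)
  have "degree ([:of_nat l, 1:] * pos_prod S) \<le> degree [:of_nat l, 1 :: rat:] + degree (pos_prod S)"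
    by (rule degree_mult_le)
  with insert show ?case by (simp add: pos_prod_def del: mult_pCons_left)
qed (auto simp: pos_prod_def)

lemma prod_upper:
  assumes "x \<le> m" "m < p"
  shows "fact (m - x) * (\<Prod>l\<in>{m<..<p}. of_nat l - of_nat x) = (fact (p - 1 - x) :: rat)"
  using assms(2)
proof (induction p)
  case (Suc n)
  show ?case
  proof (cases "m = n")
    case True
    then have "{m<..<Suc n} = {}" by auto
    with True show ?thesis by simp
  next
    case False
    with Suc have "{m<..<Suc n} = insert n {m<..<n}" by auto
    moreover have "(fact (n - x) :: rat) = of_nat (n - x) * fact (n - 1 - x)"
      using False Suc assms(1) by (subst fact_reduce) auto
    ultimately show ?thesis
      using False Suc assms(1) by (simp add: of_nat_diff mult_ac)
  qed
qed auto

lemma prod_lower: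
  assumes "0 < m" "m \<le> y"
  shows "fact (y - m) * (\<Prod>l\<in>{1..<m}. of_nat l - of_nat y) = ((- 1) ^ (m - 1) * fact (y - 1) :: rat)"
  using assms
proof (induction m rule: nat_induct_non_zero)
  case (Suc m)
  let ?V = "\<lambda>m. \<Prod>l\<in>{1..<m}. of_nat l - of_nat y :: rat"
  have "{1..<Suc m} = insert m {1..<m}" using Suc by auto
  then have "fact (y - Suc m) * ?V (Suc m) = fact (y - Suc m) * ((of_nat m - of_nat y) * ?V m)"
    by simp
  also have "\<dots> = - ((of_nat (y - m) * fact (y - Suc m)) * ?V m)"
    using Suc by (simp add: of_nat_diff algebra_simps)
  also have "of_nat (y - m) * fact (y - Suc m) = (fact (y - m) :: rat)"
    using Suc by (subst (2) fact_reduce) auto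
  also have "fact (y - m) * ?V m = (- 1) ^ (m - 1) * fact (y - 1)"
    using Suc by simp
  also have "- ((- 1) ^ (m - 1) * fact (y - 1)) = ((- 1) ^ (Suc m - 1) * fact (y - 1) :: rat)"
    using Suc by (cases m) auto
  finally show ?case .
qed auto

text \<open>An exact rational identity. The factor l = x kills the summands with m < x, the factor l
  = y those with m > y. In between, with d = y - x and j = m - x, the factorials combine to a
  constant times (-1)^j (d choose j) / (x + j). The value is written so that Wilson's theorem turns
  its numerator into 1.\<close>

lemma pos_prod_kernel:
  assumes "x \<in> {1..<p}" "y \<in> {1..<p}"
  shows "(\<Sum>m = 1..<p. 1 / of_nat m * poly (pos_prod {m<..<p}) (- of_nat x) *
            poly (pos_prod {1..<m}) (- of_nat y)) =
    (if x \<le> y then - ((- 1) ^ x * fact (p - 1 - x) * fact x) / (of_nat x * of_nat y) else 0)"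
    (is "?L = _")
proof -
  let ?U = "\<lambda>m. \<Prod>l\<in>{m<..<p}. of_nat l - (of_nat x :: rat)"
  let ?V = "\<lambda>m. \<Prod>l\<in>{1..<m}. of_nat l - (of_nat y :: rat)"
  have U0: "?U m = 0" if "m < x" for m
    using that assms by (intro prod_zero) auto
  have V0: "?V m = 0" if "m > y" for m
    using that assms by (intro prod_zero) auto
  have "?L = (\<Sum>m = 1..<p. 1 / of_nat m * ?U m * ?V m)"
    by (simp add: poly_pos_prod)
  also have "\<dots> = (\<Sum>m = x..y. 1 / of_nat m * ?U m * ?V m)"
    using assms by (intro sum.mono_neutral_right) (auto simp: not_le intro!: U0 V0)
  also have "\<dots> = (if x \<le> y then - ((- 1) ^ x * fact (p - 1 - x) * fact x) / (of_nat x * of_nat y) else 0)"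
  proof (cases "x \<le> y")
    case True
    define d where "d = y - x"
    have y: "y = x + d" using True by (simp add: d_def)
    let ?c = "(- 1) ^ (x - 1) * fact (p - 1 - x) * fact (y - 1) / fact d :: rat"
    have "(\<Sum>m = x..y. 1 / of_nat m * ?U m * ?V m) = (\<Sum>j\<le>d. 1 / of_nat (x + j) * ?U (x + j) * ?V (x + j))"
      by (rule sum.reindex_bij_witness[of _ "\<lambda>j. x + j" "\<lambda>m. m - x"]) (auto simp: y)
    also have "\<dots> = (\<Sum>j\<le>d. ?c * ((- 1) ^ j * of_nat (d choose j) * (1 / of_nat (x + j))))"
    proof (intro sum.cong refl)
      fix j assume "j \<in> {..d}"
      then have j: "j \<le> d" by simp
      have 1: "?U (x + j) = fact (p - 1 - x) / fact j"
        using prod_upper[of x "x + j" p] j assms y by (simp add: field_simps)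
      have 2: "?V (x + j) = (- 1) ^ (x + j - 1) * fact (y - 1) / fact (d - j)"
        using prod_lower[of "x + j" y] j assms y by (simp add: field_simps)
      have 3: "(- 1 :: rat) ^ (x + j - 1) = (- 1) ^ (x - 1) * (- 1) ^ j"
        using assms by (simp flip: power_add)
      show "1 / of_nat (x + j) * ?U (x + j) * ?V (x + j) =
          ?c * ((- 1) ^ j * of_nat (d choose j) * (1 / of_nat (x + j)))"
        unfolding 1 2 3 binomial_fact[OF j] by (simp add: field_simps)
    qed
    also have "\<dots> = ?c * (fact d * fact (x - 1) / fact (x + d))"
      using assms by (subst alternating_binomial_sum_inverse[symmetric]) (auto simp: sum_distrib_left)
    also have "\<dots> = - ((- 1) ^ x * fact (p - 1 - x) * fact x) / (of_nat x * of_nat y)"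
    proof -
      have "(fact (x + d) :: rat) = of_nat y * fact (y - 1)" "(fact x :: rat) = of_nat x * fact (x - 1)"
        "(- 1 :: rat) ^ x = - ((- 1) ^ (x - 1))"
        using assms by (auto simp: y[symmetric] fact_reduce power_eq_if)
      then show ?thesis using assms by (simp add: field_simps)
    qed
    finally show ?thesis using True by simp
  qed auto
  finally show ?thesis .
qed

definition middle_coeff :: "nat \<Rightarrow> nat \<Rightarrow> nat \<Rightarrow> rat" where
  "middle_coeff p a b =
    (\<Sum>m = 1..<p. 1 / of_nat m * poly.coeff (pos_prod {m<..<p}) a * poly.coeff (pos_prod {1..<m}) b)"

section \<open>Coefficients of U modulo p\<close>

context prime_modulus
begin

lemma pint_coeff_pos_prod: "pint (poly.coeff (pos_prod S) a)"
proof (induction S arbitrary: a rule: infinite_finite_induct)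
  case (insert l S)
  then show ?case
    by (cases a) (auto simp: pos_prod_def intro!: pint_add pint_mult)
qed (auto simp: pos_prod_def)

text \<open>Passing from x to x + 1 trades the factor p - 1 - x of the first factorial for -(x + 1),
  which is congruent to it; x = 0 is Wilson's theorem.\<close>

lemma wilson_pcong: "x \<le> p - 1 \<Longrightarrow> (- 1) ^ x * fact (p - 1 - x) * fact x \<equiv>\<^sub>p - 1"
proof (induction x)
  case 0
  have "[fact (p - 1) = - 1] (mod int p)"
    using prime_p by (rule wilson_theorem)
  then show ?case
    by (simp flip: pcong_of_int_iff)
next
  case (Suc x)
  let ?c = "(- 1) ^ x * fact (p - 1 - Suc x) * fact x :: rat"
  have pint_fact: "pint (fact n)" for n
    by (metis of_nat_fact pint_of_nat)
  have "(- 1) ^ Suc x * fact (p - 1 - Suc x) * fact (Suc x) = ?c * (0 - of_nat (Suc x))"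
    by (simp add: algebra_simps)
  also have "\<dots> \<equiv>\<^sub>p ?c * (of_nat p * 1 - of_nat (Suc x))"
    by (intro pcong_scale pcong_diff pint_mult pint_power pint_fact pcong_sym[OF pcong_0_mult] pint_uminus) auto
  also have "\<dots> = (- 1) ^ x * (of_nat (p - 1 - x) * fact (p - 1 - x - 1)) * fact x"
    using Suc.prems by (simp add: of_nat_diff)
  also have "of_nat (p - 1 - x) * fact (p - 1 - x - 1) = (fact (p - 1 - x) :: rat)"
    using Suc.prems by (subst (2) fact_reduce) auto
  also have "(- 1) ^ x * fact (p - 1 - x) * fact x \<equiv>\<^sub>p - 1"
    using Suc by simp
  finally show ?case .
qed

lemma pint_middle_coeff: "pint (middle_coeff p a b)"
  unfolding middle_coeff_def
  by (intro pint_sum pint_mult pint_inverse_nat pint_coeff_pos_prod) auto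

text \<open>The sum \<open>?T\<close> of x^(p - 1 - r) y^(p - 1 - s) U(-x, -y) is evaluated twice:
  \<open>power_sum_coeff\<close> in both variables gives the coefficient up to sign,
  \<open>pos_prod_kernel\<close> with Wilson's theorem gives the power sum. Both products omit l =
  m, so the degrees are at most p - 2 and no two exponents agree modulo p - 1.\<close>

lemma middle_coeff_pcong:
  assumes "r \<le> p - 2" "s \<le> p - 2"
  shows "middle_coeff p r s \<equiv>\<^sub>p
    (- 1) ^ (r + s) * (\<Sum>y = 1..<p. of_nat y ^ (p - 2 - s) * (\<Sum>x = 1..y. of_nat x ^ (p - 2 - r)))"
proof -
  define U where "U x y = (\<Sum>m = 1..<p. 1 / of_nat m * poly (pos_prod {m<..<p}) (- of_nat x) *
            poly (pos_prod {1..<m}) (- of_nat y))" for x y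
  have p: "p \<ge> 2" using prime_p by (rule prime_ge_2_nat)
  have U_eq: "U x y = (\<Sum>b\<le>p - 2. ((- 1) ^ b * (\<Sum>a\<le>p - 2. ((- 1) ^ a * middle_coeff p a b) * of_nat x ^ a)) * of_nat y ^ b)" for x y
  proof -
    have "U x y = (\<Sum>m = 1..<p. 1 / of_nat m * (\<Sum>a\<le>p - 2. poly.coeff (pos_prod {m<..<p}) a * (- of_nat x) ^ a) *
            (\<Sum>b\<le>p - 2. poly.coeff (pos_prod {1..<m}) b * (- of_nat y) ^ b))"
      unfolding U_def
    proof (intro sum.cong refl arg_cong2[of _ _ _ _ "(*)"] poly_eq_sum_bound)
      fix m assume "m \<in> {1..<p}"
      then show "degree (pos_prod {m<..<p}) \<le> p - 2" "degree (pos_prod {1..<m}) \<le> p - 2"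
        using degree_pos_prod[of "{m<..<p}"] degree_pos_prod[of "{1..<m}"] by auto
    qed
    also have "\<dots> = (\<Sum>m = 1..<p. \<Sum>b\<le>p - 2. \<Sum>a\<le>p - 2. 1 / of_nat m *
        (poly.coeff (pos_prod {m<..<p}) a * (- of_nat x) ^ a) * (poly.coeff (pos_prod {1..<m}) b * (- of_nat y) ^ b))"
      unfolding sum_distrib_left sum_distrib_right ..
    also have "\<dots> = (\<Sum>b\<le>p - 2. \<Sum>a\<le>p - 2. \<Sum>m = 1..<p. 1 / of_nat m *
        (poly.coeff (pos_prod {m<..<p}) a * (- of_nat x) ^ a) * (poly.coeff (pos_prod {1..<m}) b * (- of_nat y) ^ b))"
      by (simp only: sum.swap[where A = "{1..<p}"])
    also have "\<dots> = (\<Sum>b\<le>p - 2. \<Sum>a\<le>p - 2. (- 1) ^ a * (- 1) ^ b * middle_coeff p a b * of_nat x ^ a * of_nat y ^ b)"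
    proof (intro sum.cong refl)
      fix a b
      have "(- of_nat x) ^ a = (- 1) ^ a * (of_nat x ^ a :: rat)" "(- of_nat y) ^ b = (- 1) ^ b * (of_nat y ^ b :: rat)"
        by (metis power_minus)+
      then show "(\<Sum>m = 1..<p. 1 / of_nat m * (poly.coeff (pos_prod {m<..<p}) a * (- of_nat x) ^ a) *
            (poly.coeff (pos_prod {1..<m}) b * (- of_nat y) ^ b)) =
          (- 1) ^ a * (- 1) ^ b * middle_coeff p a b * of_nat x ^ a * of_nat y ^ b"
        by (simp add: middle_coeff_def sum_distrib_left sum_distrib_right mult_ac)
    qed
    finally show ?thesis
      by (simp add: sum_distrib_left sum_distrib_right mult_ac)
  qed
  have nd: "\<not> (p - 1) dvd (p - 1 - j + a)" if "a \<in> {..p - 2}" "a \<noteq> j" "j \<le> p - 2" for a j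
    using that p by (intro not_dvd_shift) auto
  let ?T = "\<Sum>x = 1..<p. of_nat x ^ (p - 1 - r) * (\<Sum>y = 1..<p. of_nat y ^ (p - 1 - s) * U x y)"
  have "?T \<equiv>\<^sub>p (\<Sum>x = 1..<p. of_nat x ^ (p - 1 - r) *
      - ((- 1) ^ s * (\<Sum>a\<le>p - 2. ((- 1) ^ a * middle_coeff p a s) * of_nat x ^ a)))"
    unfolding U_eq
    by (intro pcong_sum pcong_scale pint_power power_sum_coeff pint_mult pint_sum pint_middle_coeff nd)
       (use assms p in \<open>auto intro: pint_uminus\<close>)
  also have "\<dots> = - ((- 1) ^ s) * (\<Sum>x = 1..<p. of_nat x ^ (p - 1 - r) *
      (\<Sum>a\<le>p - 2. ((- 1) ^ a * middle_coeff p a s) * of_nat x ^ a))"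
    by (simp add: sum_distrib_left sum_negf mult_ac)
  also have "\<dots> \<equiv>\<^sub>p - ((- 1) ^ s) * - ((- 1) ^ r * middle_coeff p r s)"
    by (intro pcong_scale power_sum_coeff pint_mult pint_middle_coeff nd pint_power pint_uminus)
       (use assms p in auto)
  finally have "?T \<equiv>\<^sub>p (- 1) ^ (r + s) * middle_coeff p r s"
    by (simp add: power_add mult_ac)
  then have "(- 1) ^ (r + s) * ?T \<equiv>\<^sub>p (- 1) ^ (r + s) * ((- 1) ^ (r + s) * middle_coeff p r s)"
    by (intro pcong_scale pint_power pint_uminus) auto
  also have "\<dots> = middle_coeff p r s"
    by (simp flip: mult.assoc power_mult_distrib)
  finally have 1: "middle_coeff p r s \<equiv>\<^sub>p (- 1) ^ (r + s) * ?T"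
    by (rule pcong_sym)
  have "?T \<equiv>\<^sub>p (\<Sum>x = 1..<p. of_nat x ^ (p - 1 - r) * (\<Sum>y = 1..<p. of_nat y ^ (p - 1 - s) *
      (if x \<le> y then - (- 1) * (1 / of_nat x * (1 / of_nat y)) else 0)))"
  proof (intro pcong_sum pcong_scale pint_power)
    fix x y assume xy: "x \<in> {1..<p}" "y \<in> {1..<p}"
    have "- ((- 1) ^ x * fact (p - 1 - x) * fact x) / (of_nat x * of_nat y) =
      - (1 / of_nat x * (1 / of_nat y)) * ((- 1) ^ x * fact (p - 1 - x) * fact x :: rat)"
      by simp
    also have "\<dots> \<equiv>\<^sub>p - (1 / of_nat x * (1 / of_nat y)) * - 1"
      using xy by (intro pcong_scale pint_uminus pint_mult pint_inverse_nat wilson_pcong) auto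
    finally show "U x y \<equiv>\<^sub>p (if x \<le> y then - (- 1) * (1 / of_nat x * (1 / of_nat y)) else 0)"
      unfolding U_def pos_prod_kernel[OF xy] by (auto simp: mult_ac)
  qed auto
  also have "\<dots> = (\<Sum>x = 1..<p. \<Sum>y = 1..<p. if x \<le> y then of_nat x ^ (p - 2 - r) * of_nat y ^ (p - 2 - s) else 0)"
    unfolding sum_distrib_left
  proof (intro sum.cong refl)
    fix x y assume xy: "x \<in> {1..<p}" "y \<in> {1..<p}"
    \<comment> \<open>The kernel 1 / (x y) lowers both exponents by one.\<close>
    have "p - 1 - r = Suc (p - 2 - r)" "p - 1 - s = Suc (p - 2 - s)"
      using assms p by auto
    then show "of_nat x ^ (p - 1 - r) * (of_nat y ^ (p - 1 - s) *
        (if x \<le> y then - (- 1) * (1 / of_nat x * (1 / of_nat y)) else 0)) =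
        (if x \<le> y then of_nat x ^ (p - 2 - r) * of_nat y ^ (p - 2 - s) else (0 :: rat))"
      using xy by simp
  qed
  also have "\<dots> = (\<Sum>y = 1..<p. of_nat y ^ (p - 2 - s) * (\<Sum>x = 1..y. of_nat x ^ (p - 2 - r)))"
  proof (subst sum.swap, intro sum.cong refl)
    fix y assume y: "y \<in> {1..<p}"
    have "(\<Sum>x = 1..<p. if x \<le> y then of_nat x ^ (p - 2 - r) * of_nat y ^ (p - 2 - s) else 0) =
        (\<Sum>x = 1..y. of_nat x ^ (p - 2 - r) * (of_nat y ^ (p - 2 - s) :: rat))"
      using y by (intro sum.mono_neutral_cong_right) auto
    then show "(\<Sum>x = 1..<p. if x \<le> y then of_nat x ^ (p - 2 - r) * of_nat y ^ (p - 2 - s) else 0) =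
        of_nat y ^ (p - 2 - s) * (\<Sum>x = 1..y. (of_nat x ^ (p - 2 - r) :: rat))"
      by (simp add: sum_distrib_left mult.commute)
  qed
  finally have "?T \<equiv>\<^sub>p (\<Sum>y = 1..<p. of_nat y ^ (p - 2 - s) * (\<Sum>x = 1..y. of_nat x ^ (p - 2 - r)))" .
  then show ?thesis
    using 1 by (elim pcong_trans[OF _ pcong_scale]) (auto intro: pint_power pint_uminus)
qed

end

section \<open>A binomial sum\<close>

text \<open>Each difference q(x) - q(x + 1) has smaller degree, since the leading coefficients
  cancel.\<close>

lemma alternating_binomial_sum_poly_eq_0:
  fixes q :: "'a::{idom,ring_char_0} poly"
  assumes "degree q < d"
  shows "(\<Sum>j\<le>d. (- 1) ^ j * of_nat (d choose j) * poly q (of_nat j)) = 0"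
  using assms
proof (induction d arbitrary: q)
  case (Suc d)
  define q' where "q' = q - pcompose q [:1, 1:]"
  have "(\<Sum>j\<le>Suc d. (- 1) ^ j * of_nat (Suc d choose j) * poly q (of_nat j)) =
      (\<Sum>j\<le>d. (- 1) ^ j * of_nat (d choose j) * poly q' (of_nat j))"
    by (subst alternating_binomial_sum_Suc) (simp add: q'_def poly_pcompose)
  also have "\<dots> = 0"
  proof (cases "degree q = 0")
    case True
    then have "q' = 0"
      unfolding q'_def by (metis degree_eq_zeroE pcompose_const diff_self)
    then show ?thesis by simp
  next
    case False
    have "degree q' < degree q"
    proof -
      have deg: "degree (pcompose q [:1, 1:]) = degree q"
        by (simp add: degree_pcompose)
      have "lead_coeff (pcompose q [:1, 1:]) = lead_coeff q"
        by (subst lead_coeff_comp) auto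
      then have "poly.coeff q' (degree q) = 0"
        by (simp add: q'_def deg)
      moreover have "degree q' \<le> degree q"
        unfolding q'_def by (rule degree_diff_le) (simp_all add: deg)
      ultimately show ?thesis using False
        by (metis eq_zero_or_degree_less degree_0 neq0_conv le_neq_implies_less leading_coeff_0_iff)
    qed
    then show ?thesis using Suc by auto
  qed
  finally show ?case .
qed auto

text \<open>The binomial coefficient as a polynomial, so that it can also be evaluated where its
  upper entry is -1.\<close>

definition gbinomial_poly :: "rat poly \<Rightarrow> nat \<Rightarrow> rat poly" where
  "gbinomial_poly q r = Polynomial.smult (1 / fact r) (\<Prod>i<r. q - [:of_nat i:])"

lemma poly_gbinomial_poly: "poly (gbinomial_poly q r) x = poly q x gchoose r"
  by (simp add: gbinomial_poly_def gbinomial_prod_rev poly_prod lessThan_atLeast0)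

lemma degree_gbinomial_poly: "degree q \<le> 1 \<Longrightarrow> degree (gbinomial_poly q r) \<le> r"
proof -
  assume "degree q \<le> 1"
  then have "degree (\<Prod>i<r. q - [:of_nat i:]) \<le> (\<Sum>i<r. 1)"
    by (intro order.trans[OF degree_prod_sum_le] sum_mono) (auto intro!: degree_diff_le)
  then show ?thesis by (simp add: gbinomial_poly_def)
qed

text \<open>With j = a + 1 these are, up to sign, the terms 0 < j < k of the k-th finite difference
  of ((j - 1) choose s) ((k - 1 - j) choose t), a polynomial in j of degree at most s + t < k. The
  missing terms j = 0 and j = k form the right side; there one upper entry is -1, and (-1 choose n)
  = (-1)^n.\<close>

lemma binomial_triple_sum:
  assumes "s + t + 2 \<le> k"
  shows "(\<Sum>a\<le>k - 2. (- 1) ^ a * of_nat (a choose s) * of_nat ((k - 2 - a) choose t) * of_nat (k choose (a + 1))) =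
    (- 1) ^ s * of_nat ((k - 1) choose t) + (- 1) ^ (k + t) * (of_nat ((k - 1) choose s) :: rat)"
proof -
  define q where "q = gbinomial_poly [:- 1, 1:] s * gbinomial_poly [:of_nat (k - 1), - 1:] t"
  define T where "T j = (- 1) ^ j * of_nat (k choose j) * poly q (of_nat j)" for j
  have minus1: "(- 1 gchoose n) = ((- 1) ^ n :: rat)" for n
    by (subst gbinomial_minus) (simp flip: binomial_gbinomial add: binomial_gbinomial)
  have "degree q \<le> s + t"
    unfolding q_def by (intro order.trans[OF degree_mult_le] add_mono degree_gbinomial_poly) auto
  then have "(\<Sum>j\<le>k. T j) = 0"
    unfolding T_def using assms by (intro alternating_binomial_sum_poly_eq_0) auto
  moreover obtain k' where k: "k = Suc (Suc k')"
    using assms by (metis add_2_eq_Suc' le_Suc_ex add_Suc)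
  moreover have "(\<Sum>j\<le>Suc (Suc k'). T j) = T 0 + ((\<Sum>a\<le>k'. T (Suc a)) + T (Suc (Suc k')))"
    by (subst sum.atMost_Suc_shift) simp
  ultimately have "T 0 + (\<Sum>a\<le>k'. T (Suc a)) + T k = 0"
    by (simp only: k add.assoc)
  moreover have "T 0 = (- 1) ^ s * of_nat ((k - 1) choose t)"
    by (simp add: T_def q_def poly_gbinomial_poly minus1 binomial_gbinomial)
  moreover have "T k = (- 1) ^ (k + t) * of_nat ((k - 1) choose s)"
    by (simp add: T_def q_def poly_gbinomial_poly minus1 binomial_gbinomial k power_add)
  moreover have "(\<Sum>a\<le>k'. T (Suc a)) =
     - (\<Sum>a\<le>k'. (- 1) ^ a * of_nat (a choose s) * of_nat ((k' - a) choose t) * of_nat (k choose (a + 1)))"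
    unfolding sum_negf[symmetric]
    by (intro sum.cong) (auto simp: T_def q_def poly_gbinomial_poly binomial_gbinomial k of_nat_diff)
  ultimately show ?thesis by (simp add: k)
qed

section \<open>Power series modulo a prime\<close>

context prime_modulus
begin

definition fint :: "rat fps \<Rightarrow> bool" where
  "fint F \<longleftrightarrow> (\<forall>j. pint (fps_nth F j))"

definition fcong :: "nat \<Rightarrow> rat fps \<Rightarrow> rat fps \<Rightarrow> bool" where
  "fcong N F G \<longleftrightarrow> (\<forall>j<N. fps_nth F j \<equiv>\<^sub>p fps_nth G j)"

lemma fint_1 [simp]: "fint 1"
  by (auto simp: fint_def)

lemma fint_uminus: "fint F \<Longrightarrow> fint (- F)"
  by (auto simp: fint_def)

lemma fint_mult: "fint F \<Longrightarrow> fint G \<Longrightarrow> fint (F * G)"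
  by (auto simp: fint_def fps_mult_nth)

lemma fint_power: "fint F \<Longrightarrow> fint (F ^ n)"
  by (induction n) (auto intro: fint_mult)

lemma fint_sum: "(\<And>x. x \<in> A \<Longrightarrow> fint (f x)) \<Longrightarrow> fint (sum f A)"
  by (auto simp: fint_def fps_sum_nth)

lemma pint_inverse_power: "0 < m \<Longrightarrow> m < p \<Longrightarrow> pint (1 / of_nat m ^ j)"
  using pint_power[OF pint_inverse_nat, of m j] by (simp add: power_one_over)

lemma fint_geom1: "m \<in> {1..<p} \<Longrightarrow> fint (geom1 m)"
  and fint_geom2: "m \<in> {1..<p} \<Longrightarrow> fint (geom2 m)"
  by (auto simp: fint_def geom1_def geom2_def intro!: pint_inverse_power)

lemma fint_chain_sum:
  assumes "S \<subseteq> {1..<p}"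
  shows "fint (chain_sum R geom1 S r)"
  unfolding chain_sum_def
proof (rule fint_sum)
  fix ms assume "ms \<in> {ms. length ms = r \<and> set ms \<subseteq> S \<and> sorted_wrt R ms}"
  then have "set ms \<subseteq> {1..<p}" using assms by auto
  then show "fint (prod_list (map geom1 ms))"
    by (induction ms) (auto intro!: fint_mult fint_geom1)
qed

lemma fcong_refl [simp]: "fcong N F F"
  by (simp add: fcong_def)

lemma fcong_sym: "fcong N F G \<Longrightarrow> fcong N G F"
  by (auto simp: fcong_def intro: pcong_sym)

lemma fcong_trans [trans]: "fcong N F G \<Longrightarrow> fcong N G H \<Longrightarrow> fcong N F H"
  by (auto simp: fcong_def intro: pcong_trans)

lemma fcong_add: "fcong N F G \<Longrightarrow> fcong N F' G' \<Longrightarrow> fcong N (F + F') (G + G')"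
  by (auto simp: fcong_def intro: pcong_add)

lemma fcong_minus: "fcong N F G \<Longrightarrow> fcong N (- F) (- G)"
  by (auto simp: fcong_def intro: pcong_minus)

lemma fcong_sum: "(\<And>x. x \<in> A \<Longrightarrow> fcong N (f x) (g x)) \<Longrightarrow> fcong N (sum f A) (sum g A)"
  by (auto simp: fcong_def fps_sum_nth intro: pcong_sum)

lemma fcong_mult:
  assumes "fcong N F G" "fcong N F' G'" "fint G" "fint F'"
  shows "fcong N (F * F') (G * G')"
  using assms unfolding fcong_def fint_def fps_mult_nth
  by (auto intro!: pcong_sum pcong_mult)

lemma fcong_scale: "fint C \<Longrightarrow> fcong N F G \<Longrightarrow> fcong N (C * F) (C * G)"
  unfolding fcong_def fint_def fps_mult_nth by (auto intro!: pcong_sum pcong_scale)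

text \<open>The polynomial vanishes at every -x, so \<open>power_sum_coeff\<close> yields 0 for 0 <
  a < p - 1. It cannot isolate a = 0: the degree is p - 1, and x^0 and x^(p - 1) agree modulo
  \<open>p\<close> for 0 < x < p. Wilson's theorem supplies that coefficient.\<close>

lemma coeff_pos_prod_pcong:
  assumes "a < p - 1"
  shows "poly.coeff (pos_prod {1..<p}) a \<equiv>\<^sub>p (if a = 0 then - 1 else 0)"
proof (cases "a = 0")
  case True
  have "poly.coeff (pos_prod {1..<p}) 0 = poly (pos_prod {1..<p}) 0"
    by (simp add: poly_0_coeff_0)
  also have "\<dots> = fact (p - 1)"
  proof -
    have "{1..<p} = {1..p - 1}" using assms by auto
    then show ?thesis by (simp add: poly_pos_prod fact_prod)
  qed
  finally show ?thesis using wilson_pcong[of 0] True by simp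
next
  case False
  let ?c = "\<lambda>b. (- 1) ^ b * poly.coeff (pos_prod {1..<p}) b"
  have "(\<Sum>b\<le>p - 1. ?c b * of_nat x ^ b) = 0" if "x \<in> {1..<p}" for x
  proof -
    have "(\<Sum>b\<le>p - 1. ?c b * of_nat x ^ b) = (\<Sum>b\<le>p - 1. poly.coeff (pos_prod {1..<p}) b * (- of_nat x) ^ b)"
    proof (intro sum.cong refl)
      fix b
      have "(- of_nat x) ^ b = (- 1) ^ b * (of_nat x ^ b :: rat)"
        by (metis power_minus)
      then show "?c b * of_nat x ^ b = poly.coeff (pos_prod {1..<p}) b * (- of_nat x) ^ b"
        by simp
    qed
    also have "\<dots> = poly (pos_prod {1..<p}) (- of_nat x)"
      using degree_pos_prod[of "{1..<p}"] by (intro poly_eq_sum_bound[symmetric]) auto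
    also have "\<dots> = 0"
      using that unfolding poly_pos_prod by (intro prod_zero) auto
    finally show ?thesis .
  qed
  then have "0 = (\<Sum>x = 1..<p. of_nat x ^ (p - 1 - a) * (\<Sum>b\<le>p - 1. ?c b * of_nat x ^ b))"
    by simp
  also have "\<dots> \<equiv>\<^sub>p - ?c a"
    using assms False
    by (intro power_sum_coeff not_dvd_shift pint_mult pint_coeff_pos_prod pint_power pint_uminus) auto
  finally have "- ((- 1) ^ a) * 0 \<equiv>\<^sub>p - ((- 1) ^ a) * - ?c a"
    by (intro pcong_scale pint_uminus pint_power) auto
  moreover have "- ((- 1) ^ a) * - ?c a = poly.coeff (pos_prod {1..<p}) a"
    by (simp flip: mult.assoc power_mult_distrib)
  ultimately show ?thesis using False by (auto intro: pcong_sym)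
qed

text \<open>In \<open>lin_prod_chain_sum\<close> only a = 0 survives below order p - 1, and
  \<open>0 choose r\<close> is 0 unless r = 0.\<close>

lemma lin_prod_chain_sum_fcong:
  "fcong (p - 1) (lin_prod {1..<p} * chain_sum (>) geom1 {1..<p} r) (if r = 0 then - 1 else 0)"
  unfolding fcong_def
proof (intro allI impI)
  fix a assume a: "a < p - 1"
  have "fps_nth (lin_prod {1..<p} * chain_sum (>) geom1 {1..<p} r) a =
      (- 1) ^ (a + r) * of_nat (a choose r) * poly.coeff (pos_prod {1..<p}) a"
    by (rule lin_prod_chain_sum) auto
  also have "\<dots> \<equiv>\<^sub>p (- 1) ^ (a + r) * of_nat (a choose r) * (if a = 0 then - 1 else 0)"
    using a by (intro pcong_scale coeff_pos_prod_pcong pint_mult pint_power pint_uminus) auto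
  also have "\<dots> = fps_nth (if r = 0 then - 1 else 0) a"
    by (cases "a = 0"; cases r) auto
  finally show "fps_nth (lin_prod {1..<p} * chain_sum (>) geom1 {1..<p} r) a \<equiv>\<^sub>p
      fps_nth (if r = 0 then - 1 else 0) a" .
qed

lemma lin_prod_fcong: "fcong (p - 1) (lin_prod {1..<p}) (- 1)"
  using lin_prod_chain_sum_fcong[of 0] by simp

lemma lin_prod_mult_fcong: "fint F \<Longrightarrow> fcong (p - 1) (lin_prod {1..<p} * F) (- F)"
  using fcong_mult[OF lin_prod_fcong fcong_refl, of F] by (simp add: fint_uminus)

lemma chain_sum_full_fcong: "fcong (p - 1) (chain_sum (>) geom1 {1..<p} (Suc r)) 0"
proof -
  let ?E = "chain_sum (>) geom1 {1..<p} (Suc r)"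
  have "fcong (p - 1) (- ?E) (lin_prod {1..<p} * ?E)"
    by (intro fcong_sym[OF lin_prod_mult_fcong] fint_chain_sum) auto
  also have "fcong (p - 1) (lin_prod {1..<p} * ?E) 0"
    using lin_prod_chain_sum_fcong[of "Suc r"] by simp
  finally show ?thesis using fcong_minus[of _ "- ?E" 0] by simp
qed

lemma signed_chain_sum_full_fcong: "fcong (p - 1) 0 ((- 1) ^ r * chain_sum (>) geom1 {1..<p} (Suc r))"
  using fcong_scale[OF _ chain_sum_full_fcong, of "(- 1) ^ r" r]
  by (auto intro: fcong_sym simp: fint_power fint_uminus)

text \<open>Complete homogeneous sums over one part of \<open>{1..<p}\<close> are, up to sign, elementary symmetric sums
  over the complement, since the elementary symmetric sums of the whole set vanish.\<close>

lemma weak_chain_sum_fcong_step: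
  assumes E: "\<And>r. E n (Suc r) = E (Suc n) (Suc r) + f n * E (Suc n) r"
    and H: "\<And>r. H (Suc n) (Suc r) = H n (Suc r) + f n * H (Suc n) r"
    and 0: "H (Suc n) 0 = E (Suc n) 0"
    and "\<And>r. fcong N (H n r) ((- 1) ^ r * E n r)" "fint (f n)" "\<And>r. fint (H (Suc n) r)"
  shows "fcong N (H (Suc n) r) ((- 1) ^ r * E (Suc n) r)"
proof (induction r)
  case (Suc r)
  have "fcong N (H n (Suc r) + f n * H (Suc n) r) ((- 1) ^ Suc r * E n (Suc r) + f n * ((- 1) ^ r * E (Suc n) r))"
    by (intro fcong_add assms fcong_scale Suc)
  also have "(- 1) ^ Suc r * E n (Suc r) + f n * ((- 1) ^ r * E (Suc n) r) = (- 1) ^ Suc r * E (Suc n) (Suc r)"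
    by (simp add: E algebra_simps)
  finally show ?case by (simp only: H)
qed (simp add: 0)

text \<open>Here \<open>n\<close> counts the elements moved, largest first, from the strict to the
  weak side. Moving one with series f divides both generating functions in t, of the weak sums and
  of the strict sums with alternating signs, by 1 - f t. The start n = 0 is the vanishing of the
  strict sums of positive degree over the whole range.\<close>

lemma weak_chain_sum_upper_fcong:
  assumes "n \<le> p - 1"
  shows "fcong (p - 1) (chain_sum (\<ge>) geom1 {p - n..<p} r) ((- 1) ^ r * chain_sum (>) geom1 {1..<p - n} r)"
  using assms
proof (induction n arbitrary: r)
  case 0
  show ?case
    using fcong_minus[OF signed_chain_sum_full_fcong] by (cases r) auto
next
  case (Suc n)
  have 1: "{1..<p - n} = insert (p - Suc n) {1..<p - Suc n}"
    and 2: "{p - Suc n..<p} = insert (p - Suc n) {p - n..<p}"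
    using Suc.prems by auto
  show ?case
  proof (rule weak_chain_sum_fcong_step[where f = "\<lambda>n. geom1 (p - Suc n)" and H = "\<lambda>n. chain_sum (\<ge>) geom1 {p - n..<p}"
        and E = "\<lambda>n. chain_sum (>) geom1 {1..<p - n}"])
    show "chain_sum (>) geom1 {1..<p - n} (Suc r) =
        chain_sum (>) geom1 {1..<p - Suc n} (Suc r) + geom1 (p - Suc n) * chain_sum (>) geom1 {1..<p - Suc n} r" for r
      unfolding 1 by (rule chain_sum_strict_insert_top) auto
    show "chain_sum (\<ge>) geom1 {p - Suc n..<p} (Suc r) =
        chain_sum (\<ge>) geom1 {p - n..<p} (Suc r) + geom1 (p - Suc n) * chain_sum (\<ge>) geom1 {p - Suc n..<p} r" for r
      unfolding 2 using Suc.prems by (intro chain_sum_weak_insert_bot) auto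
  qed (use Suc in \<open>auto intro!: fint_geom1 fint_chain_sum\<close>)
qed

lemma weak_chain_sum_lower_fcong:
  assumes "n \<le> p - 1"
  shows "fcong (p - 1) (chain_sum (\<ge>) geom1 {1..n} r) ((- 1) ^ r * chain_sum (>) geom1 {n<..<p} r)"
  using assms
proof (induction n arbitrary: r)
  case 0
  have "{0<..<p} = {1..<p}" by auto
  then show ?case
    using fcong_minus[OF signed_chain_sum_full_fcong] by (cases r) auto
next
  case (Suc n)
  have 1: "{n<..<p} = insert (Suc n) {Suc n<..<p}"
    and 2: "{1..Suc n} = insert (Suc n) {1..n}"
    using Suc.prems by auto
  show ?case
  proof (rule weak_chain_sum_fcong_step[where f = "\<lambda>n. geom1 (Suc n)" and H = "\<lambda>n. chain_sum (\<ge>) geom1 {1..n}"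
        and E = "\<lambda>n. chain_sum (>) geom1 {n<..<p}"])
    show "chain_sum (>) geom1 {n<..<p} (Suc r) =
        chain_sum (>) geom1 {Suc n<..<p} (Suc r) + geom1 (Suc n) * chain_sum (>) geom1 {Suc n<..<p} r" for r
      unfolding 1 by (rule chain_sum_strict_insert_bot) auto
    show "chain_sum (\<ge>) geom1 {1..Suc n} (Suc r) =
        chain_sum (\<ge>) geom1 {1..n} (Suc r) + geom1 (Suc n) * chain_sum (\<ge>) geom1 {1..Suc n} r" for r
      unfolding 2 by (intro chain_sum_weak_insert_top) auto
  qed (use Suc in \<open>auto intro!: fint_geom1 fint_chain_sum\<close>)
qed

end

section \<open>The sum formula\<close>

text \<open>The coefficient of a product runs over all lists with sum \<open>k\<close>, zeros
  allowed. Those outside \<open>index_set\<close> contribute 0, because \<open>geom1\<close> starts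
  at X and \<open>geom2\<close> at X^2.\<close>

lemma sum_index_set:
  assumes "length ms = n" "1 \<le> i" "i \<le> n"
  shows "(\<Sum>ks\<in>index_set k n i. \<Prod>j<n. 1 / of_nat (ms ! j) ^ (ks ! j)) =
    fps_nth (\<Prod>j<n. (if j = i - 1 then geom2 else geom1) (ms ! j)) k"
proof -
  let ?F = "\<lambda>j. (if j = i - 1 then geom2 else geom1) (ms ! j)"
  obtain n' where n: "n = Suc n'" using assms by (cases n) auto
  have "fps_nth (prod ?F {..<n}) k = fps_nth (prod ?F {0..n'}) k"
    by (simp only: n lessThan_Suc_atMost atMost_atLeast0)
  also have "\<dots> = (\<Sum>ks\<in>natpermute k n. \<Prod>j<n. fps_nth (?F j) (ks ! j))"
    unfolding fps_prod_nth
    by (simp only: n Suc_eq_plus1[symmetric] lessThan_Suc_atMost atMost_atLeast0)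
  also have "\<dots> = (\<Sum>ks\<in>index_set k n i. \<Prod>j<n. 1 / of_nat (ms ! j) ^ (ks ! j))"
  proof (intro sum.mono_neutral_cong_right ballI natpermute_finite)
    show "index_set k n i \<subseteq> natpermute k n"
      by (auto simp: index_set_def natpermute_def)
  next
    fix ks assume "ks \<in> natpermute k n - index_set k n i"
    then have ks: "length ks = n" "(\<exists>x\<in>set ks. x < 1) \<or> ks ! (i - 1) < 2"
      by (auto simp: index_set_def natpermute_def not_le)
    then have "\<exists>j<n. fps_nth (?F j) (ks ! j) = 0"
    proof (elim disjE bexE)
      fix x assume "x \<in> set ks" "x < 1"
      then obtain j where "j < n" "ks ! j = 0" using ks by (auto simp: in_set_conv_nth)
      then show ?thesis by (intro exI[of _ j]) (auto simp: geom1_def geom2_def)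
    next
      assume "ks ! (i - 1) < 2"
      then show ?thesis using assms by (intro exI[of _ "i - 1"]) (auto simp: geom2_def)
    qed
    then obtain j where "j < n" "fps_nth (?F j) (ks ! j) = 0" by blast
    then show "(\<Prod>j<n. fps_nth (?F j) (ks ! j)) = 0"
      by (intro prod_zero bexI[of _ j]) simp_all
  next
    fix ks assume ks: "ks \<in> index_set k n i"
    show "(\<Prod>j<n. fps_nth (?F j) (ks ! j)) = (\<Prod>j<n. 1 / of_nat (ms ! j) ^ (ks ! j))"
    proof (intro prod.cong refl)
      fix j assume "j \<in> {..<n}"
      with ks have "1 \<le> ks ! j" "2 \<le> ks ! (i - 1)" by (auto simp: index_set_def)
      then show "fps_nth (?F j) (ks ! j) = 1 / of_nat (ms ! j) ^ (ks ! j)"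
        by (auto simp: geom1_def geom2_def)
    qed
  qed
  finally show ?thesis ..
qed

text \<open>The series G of the overview for either order, with r = i - 1 and s = n - i.\<close>

definition middle_sum :: "(nat \<Rightarrow> nat \<Rightarrow> bool) \<Rightarrow> nat \<Rightarrow> nat \<Rightarrow> nat \<Rightarrow> rat fps" where
  "middle_sum R p r s =
    (\<Sum>m = 1..<p. geom2 m * chain_sum R geom1 {x \<in> {1..<p}. R x m} r * chain_sum R geom1 {x \<in> {1..<p}. R m x} s)"

lemma middle_sum_strict:
  "middle_sum (>) p r s =
    (\<Sum>m = 1..<p. geom2 m * chain_sum (>) geom1 {m<..<p} r * chain_sum (>) geom1 {1..<m} s)"
  unfolding middle_sum_def
proof (intro sum.cong refl arg_cong2[of _ _ _ _ "(*)"] arg_cong2[of _ _ _ _ "chain_sum (>) geom1"])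
  fix m assume "m \<in> {1..<p}"
  then show "{x \<in> {1..<p}. x > m} = {m<..<p}" "{x \<in> {1..<p}. m > x} = {1..<m}" by auto
qed

lemma middle_sum_weak:
  "middle_sum (\<ge>) p r s =
    (\<Sum>m = 1..<p. geom2 m * chain_sum (\<ge>) geom1 {m..<p} r * chain_sum (\<ge>) geom1 {1..m} s)"
  unfolding middle_sum_def
proof (intro sum.cong refl arg_cong2[of _ _ _ _ "(*)"] arg_cong2[of _ _ _ _ "chain_sum (\<ge>) geom1"])
  fix m assume "m \<in> {1..<p}"
  then show "{x \<in> {1..<p}. x \<ge> m} = {m..<p}" "{x \<in> {1..<p}. m \<ge> x} = {1..m}" by auto
qed

text \<open>The full product splits into the factor at \<open>m\<close>, those above and those
  below, and each part clears the denominators of its own factor of the summand. What remains of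
  \<open>geom2\<close> is X^2 / m, so the degrees of the outer parts add up to k - 2.\<close>

lemma lin_prod_middle_sum:
  assumes "k \<ge> 2"
  shows "fps_nth (lin_prod {1..<p} * middle_sum (>) p r s) k =
    (- 1) ^ (k + r + s) * (\<Sum>a\<le>k - 2. of_nat (a choose r) * of_nat ((k - 2 - a) choose s) * middle_coeff p a (k - 2 - a))"
proof -
  let ?F = "\<lambda>S r. lin_prod S * chain_sum (>) geom1 S r"
  have "lin_prod {1..<p} * middle_sum (>) p r s =
      (\<Sum>m = 1..<p. fps_X ^ 2 * (fps_const (1 / of_nat m) * (?F {m<..<p} r * ?F {1..<m} s)))"
    unfolding middle_sum_strict sum_distrib_left
  proof (intro sum.cong refl)
    fix m assume m: "m \<in> {1..<p}"
    have "{1..<p} = insert m ({m<..<p} \<union> {1..<m})" using m by auto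
    moreover have "lin_prod ({m<..<p} \<union> {1..<m}) = lin_prod {m<..<p} * lin_prod {1..<m}"
      unfolding lin_prod_def by (rule prod.union_disjoint) auto
    ultimately have "lin_prod {1..<p} = (fps_const (of_nat m) - fps_X) * (lin_prod {m<..<p} * lin_prod {1..<m})"
      using m by (simp add: lin_prod_def)
    then have "lin_prod {1..<p} * (geom2 m * chain_sum (>) geom1 {m<..<p} r * chain_sum (>) geom1 {1..<m} s) =
        ((fps_const (of_nat m) - fps_X) * geom2 m) * (?F {m<..<p} r * ?F {1..<m} s)"
      by (simp add: mult_ac)
    also have "\<dots> = fps_X ^ 2 * (fps_const (1 / of_nat m) * (?F {m<..<p} r * ?F {1..<m} s))"
      using m by (subst geom2_mult) (auto simp: mult_ac)
    finally show "lin_prod {1..<p} * (geom2 m * chain_sum (>) geom1 {m<..<p} r * chain_sum (>) geom1 {1..<m} s) =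
      fps_X ^ 2 * (fps_const (1 / of_nat m) * (?F {m<..<p} r * ?F {1..<m} s))" .
  qed
  then have "fps_nth (lin_prod {1..<p} * middle_sum (>) p r s) k =
      (\<Sum>m = 1..<p. fps_nth (fps_const (1 / of_nat m) * (?F {m<..<p} r * ?F {1..<m} s)) (k - 2))"
    using assms by (simp add: fps_sum_nth fps_X_power_mult_nth)
  also have "\<dots> = (\<Sum>m = 1..<p. \<Sum>a\<le>k - 2. (- 1) ^ (k + r + s) *
      (of_nat (a choose r) * of_nat ((k - 2 - a) choose s) *
       (1 / of_nat m * poly.coeff (pos_prod {m<..<p}) a * poly.coeff (pos_prod {1..<m}) (k - 2 - a))))"
    unfolding fps_mult_left_const_nth fps_mult_nth[of "?F _ r" "?F _ s"] sum_distrib_left atLeast0AtMost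
  proof (intro sum.cong refl)
    fix m a assume m: "m \<in> {1..<p}" and a: "a \<in> {..k - 2}"
    have 1: "fps_nth (?F {m<..<p} r) a = (- 1) ^ (a + r) * of_nat (a choose r) * poly.coeff (pos_prod {m<..<p}) a"
      using m by (intro lin_prod_chain_sum) auto
    have 2: "fps_nth (?F {1..<m} s) (k - 2 - a) =
        (- 1) ^ (k - 2 - a + s) * of_nat ((k - 2 - a) choose s) * poly.coeff (pos_prod {1..<m}) (k - 2 - a)"
      using m by (intro lin_prod_chain_sum) auto
    have "k + r + s = (a + r) + (k - 2 - a + s) + 2"
      using a assms by auto
    then have 3: "(- 1 :: rat) ^ (k + r + s) = (- 1) ^ (a + r) * (- 1) ^ (k - 2 - a + s)"
      by (simp only: power_add power2_minus power_one mult_1_right)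
    show "1 / of_nat m * (fps_nth (?F {m<..<p} r) a * fps_nth (?F {1..<m} s) (k - 2 - a)) =
      (- 1) ^ (k + r + s) * (of_nat (a choose r) * of_nat ((k - 2 - a) choose s) *
       (1 / of_nat m * poly.coeff (pos_prod {m<..<p}) a * poly.coeff (pos_prod {1..<m}) (k - 2 - a)))"
      unfolding 1 2 3 by (simp add: mult_ac)
  qed
  also have "\<dots> = (- 1) ^ (k + r + s) *
      (\<Sum>a\<le>k - 2. of_nat (a choose r) * of_nat ((k - 2 - a) choose s) * middle_coeff p a (k - 2 - a))"
    unfolding middle_coeff_def sum_distrib_left by (rule sum.swap)
  finally show ?thesis .
qed

section \<open>From the components at p to elements of the ring\<close>

definition trunc_sum :: "(nat \<Rightarrow> nat \<Rightarrow> bool) \<Rightarrow> nat list \<Rightarrow> nat \<Rightarrow> int" where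
  "trunc_sum R ks p = (\<Sum>ms | length ms = length ks \<and> set ms \<subseteq> {1..<p} \<and> sorted_wrt R ms.
       modular_inverse (int p) (\<Prod>j<length ks. int (ms ! j) ^ (ks ! j)))"

lemma sum_elem_A: "finite A \<Longrightarrow> (\<Sum>x\<in>A. elem_A (f x)) = elem_A (\<lambda>p. \<Sum>x\<in>A. f x p)"
proof (induction A rule: finite_induct)
  case empty
  show ?case by (simp add: zero_ring_A.abs_eq elem_A.abs_eq)
next
  case (insert x A)
  then show ?case by (simp add: plus_ring_A.abs_eq elem_A.abs_eq)
qed

lemma of_int_times_elem_A: "of_int c * elem_A f = elem_A (\<lambda>p. c * f p)"
proof -
  have nat: "of_nat c = elem_A (\<lambda>p. int c)" for c
    by (induction c) (simp_all add: zero_ring_A.abs_eq one_ring_A.abs_eq plus_ring_A.abs_eq elem_A.abs_eq)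
  have "of_int c = elem_A (\<lambda>p. c)"
    by (cases c rule: int_cases2) (simp_all add: nat uminus_ring_A.abs_eq elem_A.abs_eq)
  then show ?thesis by (simp add: times_ring_A.abs_eq elem_A.abs_eq)
qed

context prime_modulus
begin

lemma middle_sum_strict_pcong:
  assumes "k + 1 < p" "r + s + 2 \<le> k"
  shows "fps_nth (middle_sum (>) p r s) k \<equiv>\<^sub>p
    (- 1) ^ r * (of_nat ((k - 1) choose r) + (- 1) ^ (r + s + 1) * of_nat ((k - 1) choose s)) *
      (bernoulli (p - k) / of_nat k)"
proof -
  define \<beta> where "\<beta> = bernoulli (p - k) / of_nat k"
  have \<beta>: "pint \<beta>"
    unfolding \<beta>_def using assms by (intro pint_divide_nat pint_bernoulli) auto
  let ?D = "lin_prod {1..<p}" and ?M = "middle_sum (>) p r s"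
  have "fint ?M"
    unfolding middle_sum_def by (intro fint_sum fint_mult fint_geom2 fint_chain_sum) auto
  then have "fcong (p - 1) (?D * ?M) (- ?M)"
    by (rule lin_prod_mult_fcong)
  \<comment> \<open>The product is -1 only up to order p - 1, so k < p - 1 is needed.\<close>
  then have "fps_nth (?D * ?M) k \<equiv>\<^sub>p fps_nth (- ?M) k"
    using assms by (auto simp: fcong_def)
  then have "fps_nth ?M k \<equiv>\<^sub>p - fps_nth (?D * ?M) k"
    using pcong_minus pcong_sym by fastforce
  also have "- fps_nth (?D * ?M) k = - ((- 1) ^ (k + r + s)) *
      (\<Sum>a\<le>k - 2. of_nat (a choose r) * of_nat ((k - 2 - a) choose s) * middle_coeff p a (k - 2 - a))"
    using assms by (subst lin_prod_middle_sum) auto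
  also have "\<dots> \<equiv>\<^sub>p - ((- 1) ^ (k + r + s)) *
      (\<Sum>a\<le>k - 2. of_nat (a choose r) * of_nat ((k - 2 - a) choose s) * ((- 1) ^ (a + 1) * of_nat (k choose (a + 1)) * \<beta>))"
  proof (intro pcong_scale pcong_sum pint_mult pint_uminus pint_power)
    fix a assume "a \<in> {..k - 2}"
    then have a: "k = a + (k - 2 - a) + 2" using assms by auto
    have "middle_coeff p a (k - 2 - a) \<equiv>\<^sub>p (- 1) ^ (a + (k - 2 - a)) *
        (\<Sum>y = 1..<p. of_nat y ^ (p - 2 - (k - 2 - a)) * (\<Sum>x = 1..y. of_nat x ^ (p - 2 - a)))"
      using a assms by (intro middle_coeff_pcong) auto
    also have "\<dots> \<equiv>\<^sub>p (- 1) ^ (a + (k - 2 - a)) *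
        ((- 1) ^ (k - 2 - a + 1) * of_nat (k choose (a + 1)) * (bernoulli (p - k) / of_nat k))"
      using assms by (intro pcong_scale double_power_sum_pcong a pint_power pint_uminus) auto
    also have "\<dots> = ((- 1) ^ (k - 2 - a) * (- 1) ^ (k - 2 - a)) * ((- 1) ^ (a + 1) * of_nat (k choose (a + 1)) * \<beta>)"
      by (simp add: \<beta>_def power_add)
    also have "(- 1) ^ (k - 2 - a) * (- 1) ^ (k - 2 - a) = (1 :: rat)"
      by (simp flip: power_mult_distrib)
    finally show "middle_coeff p a (k - 2 - a) \<equiv>\<^sub>p (- 1) ^ (a + 1) * of_nat (k choose (a + 1)) * \<beta>"
      by simp
  qed auto
  also have "\<dots> = (- 1) ^ (k + r + s) * \<beta> *
      (\<Sum>a\<le>k - 2. (- 1) ^ a * of_nat (a choose r) * of_nat ((k - 2 - a) choose s) * of_nat (k choose (a + 1)))"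
    by (simp add: sum_distrib_left sum_negf mult_ac)
  also have "\<dots> = (- 1) ^ (k + r + s) * \<beta> *
      ((- 1) ^ r * of_nat ((k - 1) choose s) + (- 1) ^ (k + s) * of_nat ((k - 1) choose r))"
    using assms by (subst binomial_triple_sum) auto
  also have "\<dots> = (- 1) ^ r * (of_nat ((k - 1) choose r) + (- 1) ^ (r + s + 1) * of_nat ((k - 1) choose s)) * \<beta>"
  \<comment> \<open>The two sides differ by a factor -(-1)^k at the binomial with \<open>s\<close>.
    For even \<open>k\<close>, p - k is odd and exceeds 1, so both sides are 0.\<close>
  proof (cases "even k")
    case True
    have "odd p" using prime_p assms by (intro prime_odd_nat) auto
    then have "bernoulli (p - k) = 0"
      using True assms by (intro bernoulli_odd_eq_0) auto
    then show ?thesis by (simp add: \<beta>_def)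
  next
    case False
    then have "(- 1 :: rat) ^ k = - 1" by simp
    moreover have "(- 1) ^ s * (- 1) ^ s = (1 :: rat)" "(- 1) ^ r * (- 1) ^ r = (1 :: rat)"
      by (simp_all flip: power_mult_distrib)
    ultimately show ?thesis by (simp add: power_add algebra_simps)
  qed
  finally show ?thesis by (simp only: \<beta>_def)
qed

text \<open>Within {1..<p} the complement of {m..<p} is {1..<m} and that of {1..m} is {m<..<p}: both
  weak ranges contain \<open>m\<close>, both strict ones avoid it, and upper and lower parts trade
  places.\<close>

lemma middle_sum_weak_fcong: "fcong (p - 1) (middle_sum (\<ge>) p r s) ((- 1) ^ (r + s) * middle_sum (>) p s r)"
proof -
  have "fcong (p - 1) (middle_sum (\<ge>) p r s)
      (\<Sum>m = 1..<p. geom2 m * (((- 1) ^ r * chain_sum (>) geom1 {1..<m} r) * ((- 1) ^ s * chain_sum (>) geom1 {m<..<p} s)))"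
    unfolding middle_sum_weak mult.assoc[of "geom2 _"]
  proof (intro fcong_sum fcong_scale fcong_mult fint_mult fint_power fint_uminus fint_chain_sum)
    fix m assume m: "m \<in> {1..<p}"
    show "fcong (p - 1) (chain_sum (\<ge>) geom1 {m..<p} r) ((- 1) ^ r * chain_sum (>) geom1 {1..<m} r)"
      using weak_chain_sum_upper_fcong[of "p - m" r] m by (simp add: diff_le_mono2)
    show "fcong (p - 1) (chain_sum (\<ge>) geom1 {1..m} s) ((- 1) ^ s * chain_sum (>) geom1 {m<..<p} s)"
      using m by (intro weak_chain_sum_lower_fcong) auto
  qed (auto intro: fint_geom2)
  also have "\<dots> = (- 1) ^ (r + s) * middle_sum (>) p s r"
    by (simp add: middle_sum_strict sum_distrib_left power_add mult_ac)
  finally show ?thesis .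
qed

text \<open>Once modular inverses are replaced by rational ones, the rest is exact: for fixed
  \<open>ms\<close> the sum over the indices is one coefficient of a product, and the chains are
  then cut at the entry of position i - 1.\<close>

lemma sum_trunc_sum_pcong:
  assumes "transp R" "1 \<le> i" "i \<le> n"
  shows "of_int (\<Sum>ks\<in>index_set k n i. trunc_sum R ks p) \<equiv>\<^sub>p fps_nth (middle_sum R p (i - 1) (n - i)) k"
proof -
  let ?C = "{ms. length ms = n \<and> set ms \<subseteq> {1..<p} \<and> sorted_wrt R ms}"
  have "of_int (\<Sum>ks\<in>index_set k n i. trunc_sum R ks p) =
      (\<Sum>ks\<in>index_set k n i. \<Sum>ms\<in>?C. of_int (modular_inverse (int p) (\<Prod>j<n. int (ms ! j) ^ (ks ! j))))"
    by (auto simp: trunc_sum_def index_set_def intro!: sum.cong)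
  also have "\<dots> \<equiv>\<^sub>p (\<Sum>ks\<in>index_set k n i. \<Sum>ms\<in>?C. \<Prod>j<n. 1 / of_nat (ms ! j) ^ (ks ! j))"
  proof (intro pcong_sum)
    fix ks ms assume "ms \<in> ?C"
    then have "ms ! j \<in> {1..<p}" if "j < n" for j
      using that by (auto dest: nth_mem)
    then have "\<not> int p dvd int (ms ! j) ^ (ks ! j)" if "j < n" for j
      using that prime_dvd_power[OF prime_int_p, of "int (ms ! j)"] by (fastforce dest: nat_dvd_not_less)
    then have "\<not> int p dvd (\<Prod>j<n. int (ms ! j) ^ (ks ! j))"
      by (simp add: prime_dvd_prod_iff[OF _ prime_int_p])
    then have "of_int (modular_inverse (int p) (\<Prod>j<n. int (ms ! j) ^ (ks ! j))) \<equiv>\<^sub>p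
        1 / of_int (\<Prod>j<n. int (ms ! j) ^ (ks ! j))"
      by (rule pcong_modular_inverse)
    also have "\<dots> = (\<Prod>j<n. 1 / of_nat (ms ! j) ^ (ks ! j))"
      by (simp add: prod_dividef)
    finally show "of_int (modular_inverse (int p) (\<Prod>j<n. int (ms ! j) ^ (ks ! j))) \<equiv>\<^sub>p
      (\<Prod>j<n. 1 / of_nat (ms ! j) ^ (ks ! j))" .
  qed
  also have "\<dots> = (\<Sum>ms\<in>?C. fps_nth (\<Prod>j<n. (if j = i - 1 then geom2 else geom1) (ms ! j)) k)"
    by (subst sum.swap, intro sum.cong refl sum_index_set) (use assms in auto)
  also have "\<dots> = fps_nth (middle_sum R p (i - 1) (n - i)) k"
    unfolding middle_sum_def fps_sum_nth[symmetric]
    using assms by (subst chain_sum_split[where r = "i - 1" and s = "n - i"]) auto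
  finally show ?thesis .
qed

lemma sum_trunc_sum_cong:
  assumes "1 \<le> i" "i \<le> n" "n \<le> k - 1" "k + 1 < p"
  shows "[(\<Sum>ks\<in>index_set k n i. trunc_sum (>) ks p) =
      (- 1) ^ (i - 1) * (int ((k - 1) choose (i - 1)) + (- 1) ^ n * int ((k - 1) choose (n - i))) *
        reduce_mod p (bernoulli (p - k) / of_nat k)] (mod int p)" (is ?strict)
    and "[(\<Sum>ks\<in>index_set k n i. trunc_sum (\<ge>) ks p) =
      (- 1) ^ (i - 1) * ((- 1) ^ n * int ((k - 1) choose (i - 1)) + int ((k - 1) choose (n - i))) *
        reduce_mod p (bernoulli (p - k) / of_nat k)] (mod int p)" (is ?weak)
proof -
  define \<beta> where "\<beta> = bernoulli (p - k) / of_nat k"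
  define b where "b = reduce_mod p \<beta>"
  have "pint \<beta>"
    unfolding \<beta>_def using assms by (intro pint_divide_nat pint_bernoulli) auto
  then have b: "\<beta> \<equiv>\<^sub>p of_int b"
    unfolding b_def by (intro pcong_sym[OF pcong_reduce_mod])
  have n: "i - 1 + (n - i) + 1 = n" "n - i + (i - 1) + 1 = n" "n - i + (i - 1) + 2 \<le> k" "i - 1 + (n - i) + 2 \<le> k"
    using assms by auto
  have "of_int (\<Sum>ks\<in>index_set k n i. trunc_sum (>) ks p) \<equiv>\<^sub>p fps_nth (middle_sum (>) p (i - 1) (n - i)) k"
    using assms by (intro sum_trunc_sum_pcong) (auto simp: transp_def)
  also have "\<dots> \<equiv>\<^sub>p (- 1) ^ (i - 1) * (of_nat ((k - 1) choose (i - 1)) + (- 1) ^ n * of_nat ((k - 1) choose (n - i))) * \<beta>"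
    using middle_sum_strict_pcong[OF assms(4) n(4)] unfolding n \<beta>_def .
  also have "\<dots> \<equiv>\<^sub>p (- 1) ^ (i - 1) * (of_nat ((k - 1) choose (i - 1)) + (- 1) ^ n * of_nat ((k - 1) choose (n - i))) * of_int b"
    by (intro pcong_scale b pint_mult pint_add pint_power pint_uminus) auto
  finally show ?strict
    unfolding b_def \<beta>_def by (simp flip: pcong_of_int_iff)
  have "of_int (\<Sum>ks\<in>index_set k n i. trunc_sum (\<ge>) ks p) \<equiv>\<^sub>p fps_nth (middle_sum (\<ge>) p (i - 1) (n - i)) k"
    using assms by (intro sum_trunc_sum_pcong) (auto simp: transp_def)
  also have "\<dots> \<equiv>\<^sub>p fps_nth ((- 1) ^ (i - 1 + (n - i)) * middle_sum (>) p (n - i) (i - 1)) k"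
    using middle_sum_weak_fcong assms(4) by (auto simp: fcong_def)
  also have "\<dots> = (- 1) ^ (i - 1 + (n - i)) * fps_nth (middle_sum (>) p (n - i) (i - 1)) k"
    by (cases "even (i - 1 + (n - i))") auto
  also have "\<dots> \<equiv>\<^sub>p (- 1) ^ (i - 1 + (n - i)) *
      ((- 1) ^ (n - i) * (of_nat ((k - 1) choose (n - i)) + (- 1) ^ n * of_nat ((k - 1) choose (i - 1))) * \<beta>)"
    using middle_sum_strict_pcong[OF assms(4) n(3)] unfolding n \<beta>_def
    by (intro pcong_scale pint_power pint_uminus) auto
  also have "\<dots> \<equiv>\<^sub>p (- 1) ^ (i - 1 + (n - i)) *
      ((- 1) ^ (n - i) * (of_nat ((k - 1) choose (n - i)) + (- 1) ^ n * of_nat ((k - 1) choose (i - 1))) * of_int b)"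
    by (intro pcong_scale b pint_mult pint_add pint_power pint_uminus) auto
  \<comment> \<open>The sign (-1)^(n - 1) from passing to strict sums and the sign (-1)^(n - i) of
    the swapped formula leave (-1)^(i - 1).\<close>
  also have "\<dots> = ((- 1) ^ (n - i) * (- 1) ^ (n - i)) * (- 1) ^ (i - 1) *
      ((- 1) ^ n * of_nat ((k - 1) choose (i - 1)) + of_nat ((k - 1) choose (n - i))) * of_int b"
    by (simp add: power_add mult_ac add.commute)
  also have "(- 1) ^ (n - i) * (- 1) ^ (n - i) = (1 :: rat)"
    by (simp flip: power_mult_distrib)
  finally show ?weak
    unfolding b_def \<beta>_def by (simp flip: pcong_of_int_iff)
qed

end

lemma zeta_A_eq: "zeta_A ks = elem_A (trunc_sum (>) ks)"
  and zeta_star_A_eq: "zeta_star_A ks = elem_A (trunc_sum (\<ge>) ks)"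
  by (simp_all add: zeta_A_def zeta_star_A_def trunc_sum_def[abs_def])

lemma elem_A_eqI:
  assumes "\<And>p. prime p \<Longrightarrow> N < p \<Longrightarrow> [a p = b p] (mod int p)"
  shows "elem_A a = elem_A b"
proof -
  have "{p. prime p \<and> \<not> [a p = b p] (mod int p)} \<subseteq> {..N}"
    using assms by (auto simp: not_less[symmetric])
  then show ?thesis
    unfolding elem_A_eq_iff by (rule finite_subset) simp
qed

theorem theorem1p4:
  fixes k n i :: nat
  assumes "1 \<le> i" and "i \<le> n" and "n \<le> k - 1"
  shows "((\<Sum>ks\<in>index_set k n i. zeta_A ks) =
           (- 1) ^ (i - 1) *
           (of_nat ((k - 1) choose (i - 1)) + (- 1) ^ n * of_nat ((k - 1) choose (n - i))) *
           bernoulli_A k) \<and>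
         ((\<Sum>ks\<in>index_set k n i. zeta_star_A ks) =
           (- 1) ^ (i - 1) *
           ((- 1) ^ n * of_nat ((k - 1) choose (i - 1)) + of_nat ((k - 1) choose (n - i))) *
           bernoulli_A k)"
proof -
  have "(\<Sum>ks\<in>index_set k n i. zeta_A ks) =
      of_int ((- 1) ^ (i - 1) * (int ((k - 1) choose (i - 1)) + (- 1) ^ n * int ((k - 1) choose (n - i)))) *
        bernoulli_A k"
    unfolding zeta_A_eq sum_elem_A[OF finite_index_set] bernoulli_A_def of_int_times_elem_A
    \<comment> \<open>The primes up to k + 1 are the finitely many exceptions; beyond them the
      subtraction p - k is not truncated.\<close>
    using assms by (intro elem_A_eqI[of "k + 1"] prime_modulus.sum_trunc_sum_cong prime_modulus.intro)
  moreover have "(\<Sum>ks\<in>index_set k n i. zeta_star_A ks) =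
      of_int ((- 1) ^ (i - 1) * ((- 1) ^ n * int ((k - 1) choose (i - 1)) + int ((k - 1) choose (n - i)))) *
        bernoulli_A k"
    unfolding zeta_star_A_eq sum_elem_A[OF finite_index_set] bernoulli_A_def of_int_times_elem_A
    using assms by (intro elem_A_eqI[of "k + 1"] prime_modulus.sum_trunc_sum_cong prime_modulus.intro)
  ultimately show ?thesis by simp
qed

end
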